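(* Let $V$ be a vector space over $\Bbbk$ with ordered basis $\{x_1,\ldots,x_n\}$, let $\mu\in M(n,\Bbbk)$ be multiplicatively antisymmetric, let $\phi:V\times V\to\Bbbk$ be a $\mu$-symmetric bilinear form relative to this basis, let $B=(B_{ij})$ with $B_{ij}=\phi(x_i,x_j)$, and let $R=\mathrm{sCl}(V,\mu,\phi)$. Let $$A=\frac{\Bbbk\langle X_1,\ldots,X_n\rangle[y]}{\langle X_iX_j+\mu_{ij}X_jX_i-2B_{ij}y\ :\ 1\le i,j\le n\rangle}.$$ If $R$ has full dimension and $B\neq 0$, then $A$ is a quadratic algebra.
   Context: $\Bbbk$ is a field with $\mathrm{char}(\Bbbk)\neq 2$. A matrix $\mu=(\mu_{ij})\in M(n,\Bbbk)$ is multiplicatively antisymmetric if $\mu_{ij}\mu_{ji}=\mu_{ii}=1$ for all $i,j$. A bilinear form $\phi$ is $\mu$-symmetric (relative to $\{x_1,\ldots,x_n\}$) if $\phi(x_i,x_j)=\mu_{ij}\phi(x_j,x_i)$ for all $i,j$. The skew Clifford algebra $\mathrm{sCl}(V,\mu,\phi)$ is the quotient of the tensor algebra $T(V)$ by the two-sided ideal generated by all elements $x_i\otimes x_j+\mu_{ij}\,x_j\otimes x_i-2\phi(x_i,x_j)\cdot 1$, for all $i,j$. It has full dimension if its dimension is $2^{\dim(V)}$. In the definition of $A$, the square brackets indicate that $y$ is central. The algebra $A$ is $\mathbb{N}$-graded with each $X_i$ of degree one and $y$ of degree two. A quadratic algebra is an $\mathbb{N}$-graded algebra generated by its degree-one elements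 with all defining relations being consequences of homogeneous relations of degree two. *)

theory Defs
  imports
    "HOL-Library.Poly_Mapping"
    "HOL-Algebra.UnivPoly"
    "HOL-Algebra.QuotRing"
    "HOL-Algebra.Embedded_Algebras"
    "HOL-Algebra.Algebraic_Closure_Type"
begin

section \<open>Free algebras\<close>

text \<open>
  Words under concatenation, written additively because \<open>poly_mapping\<close> forms the monoid
  algebra of a class \<open>monoid_add\<close>.
\<close>

datatype 'a fmonoid = Word (letters: "'a list")

instantiation fmonoid :: (type) monoid_add
begin

definition zero_fmonoid :: "'a fmonoid" where
  "zero_fmonoid = Word []"

definition plus_fmonoid :: "'a fmonoid \<Rightarrow> 'a fmonoid \<Rightarrow> 'a fmonoid" where
  "plus_fmonoid u v = Word (letters u @ letters v)"

instance
  by standard (simp_all add: zero_fmonoid_def plus_fmonoid_def)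

end

type_synonym ('a, 'k) free_alg = "'a fmonoid \<Rightarrow>\<^sub>0 'k"

definition free_algebra :: "'a set \<Rightarrow> ('a, 'k::field) free_alg ring" where
  "free_algebra S =
     \<lparr>carrier = {p. \<forall>w \<in> Poly_Mapping.keys p. set (letters w) \<subseteq> S},
      monoid.mult = (*), one = 1, zero = 0, add = (+)\<rparr>"

definition fscal :: "'k::field \<Rightarrow> ('a, 'k) free_alg" where
  "fscal c = Poly_Mapping.single 0 c"

definition fgen :: "'a \<Rightarrow> ('a, 'k::field) free_alg" where
  "fgen a = Poly_Mapping.single (Word [a]) 1"

definition fhomogeneous :: "'a set \<Rightarrow> nat \<Rightarrow> ('a, 'k::field) free_alg set" where
  "fhomogeneous S d =
     {p \<in> carrier (free_algebra S). \<forall>w \<in> Poly_Mapping.keys p. length (letters w) = d}"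


section \<open>Graded and quadratic algebras\<close>

text \<open>
  An algebra over the field \<open>'k\<close> is a ring record \<open>A\<close> together with its structure map
  \<open>\<eta>\<close> from \<open>'k\<close> into the centre of \<open>A\<close>; the scalar multiple \<open>c a\<close> is \<open>\<eta> c \<otimes> a\<close>.
\<close>

definition algebra_over :: "('a, 'm) ring_scheme \<Rightarrow> ('k::field \<Rightarrow> 'a) \<Rightarrow> bool" where
  "algebra_over A \<eta> \<longleftrightarrow>
     ring A \<and> \<eta> \<in> ring_hom ring_of_type_algebra A \<and>
     (\<forall>c. \<forall>a \<in> carrier A. \<eta> c \<otimes>\<^bsub>A\<^esub> a = a \<otimes>\<^bsub>A\<^esub> \<eta> c)"

definition graded_algebra ::
  "('a, 'm) ring_scheme \<Rightarrow> ('k::field \<Rightarrow> 'a) \<Rightarrow> (nat \<Rightarrow> 'a set) \<Rightarrow> bool" where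
  "graded_algebra A \<eta> G \<longleftrightarrow>
     algebra_over A \<eta> \<and>
     (\<forall>d. additive_subgroup (G d) A \<and> (\<forall>c. \<forall>a \<in> G d. \<eta> c \<otimes>\<^bsub>A\<^esub> a \<in> G d)) \<and>
     (\<forall>a \<in> carrier A. \<exists>!f. (\<forall>d. f d \<in> G d) \<and> finite {d. f d \<noteq> \<zero>\<^bsub>A\<^esub>} \<and>
        a = (\<Oplus>\<^bsub>A\<^esub> d \<in> {d. f d \<noteq> \<zero>\<^bsub>A\<^esub>}. f d)) \<and>
     \<one>\<^bsub>A\<^esub> \<in> G 0 \<and>
     (\<forall>d e. \<forall>a \<in> G d. \<forall>b \<in> G e. a \<otimes>\<^bsub>A\<^esub> b \<in> G (d + e))"

text \<open>
  A set \<open>S\<close> of elements of degree one generates \<open>A\<close>, i.e. the canonical map \<open>h\<close> from the free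
  algebra on \<open>S\<close> is onto, and the ideal of all relations between the elements of \<open>S\<close> is
  generated by a set \<open>Q\<close> of homogeneous relations of degree two.
\<close>

definition quadratic_algebra ::
  "('a, 'm) ring_scheme \<Rightarrow> ('k::field \<Rightarrow> 'a) \<Rightarrow> (nat \<Rightarrow> 'a set) \<Rightarrow> bool" where
  "quadratic_algebra A \<eta> G \<longleftrightarrow>
     graded_algebra A \<eta> G \<and>
     (\<exists>S \<subseteq> G 1. \<exists>h \<in> ring_hom (free_algebra S :: ('a, 'k) free_alg ring) A.
        (\<forall>c. h (fscal c) = \<eta> c) \<and> (\<forall>s \<in> S. h (fgen s) = s) \<and>
        h ` carrier (free_algebra S) = carrier A \<and>
        (\<exists>Q \<subseteq> fhomogeneous S 2. a_kernel (free_algebra S) A h = Idl\<^bsub>free_algebra S\<^esub> Q))"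


section \<open>Skew Clifford algebras\<close>

definition ordered_basis ::
  "('k::field \<Rightarrow> 'v::ab_group_add \<Rightarrow> 'v) \<Rightarrow> nat \<Rightarrow> (nat \<Rightarrow> 'v) \<Rightarrow> bool" where
  "ordered_basis scale n x \<longleftrightarrow>
     inj_on x {1..n} \<and> \<not> module.dependent scale (x ` {1..n}) \<and>
     module.span scale (x ` {1..n}) = UNIV"

definition mult_antisymmetric :: "nat \<Rightarrow> (nat \<Rightarrow> nat \<Rightarrow> 'k::field) \<Rightarrow> bool" where
  "mult_antisymmetric n \<mu> \<longleftrightarrow>
     (\<forall>i \<in> {1..n}. \<forall>j \<in> {1..n}. \<mu> i j * \<mu> j i = 1 \<and> \<mu> i i = 1)"

definition bilinear_form ::
  "('k::field \<Rightarrow> 'v::ab_group_add \<Rightarrow> 'v) \<Rightarrow> ('v \<Rightarrow> 'v \<Rightarrow> 'k) \<Rightarrow> bool" where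
  "bilinear_form scale \<phi> \<longleftrightarrow>
     (\<forall>u. Vector_Spaces.linear scale (*) (\<lambda>v. \<phi> u v)) \<and>
     (\<forall>v. Vector_Spaces.linear scale (*) (\<lambda>u. \<phi> u v))"

definition mu_symmetric ::
  "nat \<Rightarrow> (nat \<Rightarrow> 'v) \<Rightarrow> (nat \<Rightarrow> nat \<Rightarrow> 'k::field) \<Rightarrow> ('v \<Rightarrow> 'v \<Rightarrow> 'k) \<Rightarrow> bool" where
  "mu_symmetric n x \<mu> \<phi> \<longleftrightarrow>
     (\<forall>i \<in> {1..n}. \<forall>j \<in> {1..n}. \<phi> (x i) (x j) = \<mu> i j * \<phi> (x j) (x i))"

text \<open>
  The tensor algebra \<open>T(V)\<close>, where \<open>V\<close> is the type \<open>'v\<close> with scalar multiplication \<open>scale\<close>,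
  is the free algebra on the set \<open>V\<close> modulo linearity of \<open>V \<rightarrow> T(V)\<close>.
\<close>

definition tensor_ideal ::
  "('k::field \<Rightarrow> 'v::ab_group_add \<Rightarrow> 'v) \<Rightarrow> ('v, 'k) free_alg set" where
  "tensor_ideal scale = Idl\<^bsub>free_algebra UNIV\<^esub>
     ({fgen (u + v) - fgen u - fgen v | u v. True} \<union>
      {fgen (scale c v) - fscal c * fgen v | c v. True})"

definition tensor_algebra ::
  "('k::field \<Rightarrow> 'v::ab_group_add \<Rightarrow> 'v) \<Rightarrow> ('v, 'k) free_alg set ring" where
  "tensor_algebra scale = free_algebra UNIV Quot tensor_ideal scale"

definition tensor_scal ::
  "('k::field \<Rightarrow> 'v::ab_group_add \<Rightarrow> 'v) \<Rightarrow> 'k \<Rightarrow> ('v, 'k) free_alg set" where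
  "tensor_scal scale c = tensor_ideal scale +>\<^bsub>free_algebra UNIV\<^esub> fscal c"

definition tensor_vec ::
  "('k::field \<Rightarrow> 'v::ab_group_add \<Rightarrow> 'v) \<Rightarrow> 'v \<Rightarrow> ('v, 'k) free_alg set" where
  "tensor_vec scale v = tensor_ideal scale +>\<^bsub>free_algebra UNIV\<^esub> fgen v"

definition sCl_ideal ::
  "('k::field \<Rightarrow> 'v::ab_group_add \<Rightarrow> 'v) \<Rightarrow> nat \<Rightarrow> (nat \<Rightarrow> 'v) \<Rightarrow>
   (nat \<Rightarrow> nat \<Rightarrow> 'k) \<Rightarrow> ('v \<Rightarrow> 'v \<Rightarrow> 'k) \<Rightarrow> ('v, 'k) free_alg set set" where
  "sCl_ideal scale n x \<mu> \<phi> =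
     (let T = tensor_algebra scale; \<iota> = tensor_vec scale; \<kappa> = tensor_scal scale
      in Idl\<^bsub>T\<^esub>
           {(\<iota> (x i) \<otimes>\<^bsub>T\<^esub> \<iota> (x j)) \<oplus>\<^bsub>T\<^esub> (\<kappa> (\<mu> i j) \<otimes>\<^bsub>T\<^esub> (\<iota> (x j) \<otimes>\<^bsub>T\<^esub> \<iota> (x i)))
              \<ominus>\<^bsub>T\<^esub> \<kappa> (2 * \<phi> (x i) (x j)) | i j. i \<in> {1..n} \<and> j \<in> {1..n}})"

definition sCl ::
  "('k::field \<Rightarrow> 'v::ab_group_add \<Rightarrow> 'v) \<Rightarrow> nat \<Rightarrow> (nat \<Rightarrow> 'v) \<Rightarrow>
   (nat \<Rightarrow> nat \<Rightarrow> 'k) \<Rightarrow> ('v \<Rightarrow> 'v \<Rightarrow> 'k) \<Rightarrow> ('v, 'k) free_alg set set ring" where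
  "sCl scale n x \<mu> \<phi> = tensor_algebra scale Quot sCl_ideal scale n x \<mu> \<phi>"

definition sCl_scal ::
  "('k::field \<Rightarrow> 'v::ab_group_add \<Rightarrow> 'v) \<Rightarrow> nat \<Rightarrow> (nat \<Rightarrow> 'v) \<Rightarrow>
   (nat \<Rightarrow> nat \<Rightarrow> 'k) \<Rightarrow> ('v \<Rightarrow> 'v \<Rightarrow> 'k) \<Rightarrow> 'k \<Rightarrow> ('v, 'k) free_alg set set" where
  "sCl_scal scale n x \<mu> \<phi> c =
     sCl_ideal scale n x \<mu> \<phi> +>\<^bsub>tensor_algebra scale\<^esub> tensor_scal scale c"

text \<open>
  The dimension is taken over the image of \<open>'k\<close>. This is not satisfied by the zero ring, whose
  only dimension is \<open>0\<close>.
\<close>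

definition full_dimension ::
  "('k::field \<Rightarrow> 'v::ab_group_add \<Rightarrow> 'v) \<Rightarrow> nat \<Rightarrow> (nat \<Rightarrow> 'v) \<Rightarrow>
   (nat \<Rightarrow> nat \<Rightarrow> 'k) \<Rightarrow> ('v \<Rightarrow> 'v \<Rightarrow> 'k) \<Rightarrow> bool" where
  "full_dimension scale n x \<mu> \<phi> \<longleftrightarrow>
     ring.dimension (sCl scale n x \<mu> \<phi>) (2 ^ vector_space.dim scale (UNIV :: 'v set))
       (range (sCl_scal scale n x \<mu> \<phi>)) (carrier (sCl scale n x \<mu> \<phi>))"


section \<open>The algebra with a central generator\<close>

text \<open>
  \<open>\<k>\<langle>X\<^sub>1,\<dots>,X\<^sub>n\<rangle>[y]\<close> is the ring of univariate polynomials \<^const>\<open>UP\<close> over the (noncommutative)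
  free algebra; its variable commutes with all coefficients.
\<close>

definition free_poly :: "nat \<Rightarrow> ((nat, 'k::field) free_alg, nat \<Rightarrow> (nat, 'k) free_alg) up_ring"
  where "free_poly n = UP (free_algebra {1..n})"

definition poly_scal :: "nat \<Rightarrow> 'k::field \<Rightarrow> nat \<Rightarrow> (nat, 'k) free_alg" where
  "poly_scal n c = up_ring.monom (free_poly n) (fscal c) 0"

definition poly_X :: "nat \<Rightarrow> nat \<Rightarrow> nat \<Rightarrow> (nat, 'k::field) free_alg" where
  "poly_X n i = up_ring.monom (free_poly n) (fgen i) 0"

definition poly_y :: "nat \<Rightarrow> nat \<Rightarrow> (nat, 'k::field) free_alg" where
  "poly_y n = up_ring.monom (free_poly n) 1 1"

definition A_ideal ::
  "nat \<Rightarrow> (nat \<Rightarrow> nat \<Rightarrow> 'k::field) \<Rightarrow> (nat \<Rightarrow> nat \<Rightarrow> 'k) \<Rightarrow> (nat \<Rightarrow> (nat, 'k) free_alg) set" where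
  "A_ideal n \<mu> B =
     (let P = free_poly n; \<xi> = poly_X n; y = poly_y n; \<kappa> = poly_scal n
      in Idl\<^bsub>P\<^esub>
           {(\<xi> i \<otimes>\<^bsub>P\<^esub> \<xi> j) \<oplus>\<^bsub>P\<^esub> (\<kappa> (\<mu> i j) \<otimes>\<^bsub>P\<^esub> (\<xi> j \<otimes>\<^bsub>P\<^esub> \<xi> i))
              \<ominus>\<^bsub>P\<^esub> (\<kappa> (2 * B i j) \<otimes>\<^bsub>P\<^esub> y) | i j. i \<in> {1..n} \<and> j \<in> {1..n}})"

definition A_algebra ::
  "nat \<Rightarrow> (nat \<Rightarrow> nat \<Rightarrow> 'k::field) \<Rightarrow> (nat \<Rightarrow> nat \<Rightarrow> 'k) \<Rightarrow>
   (nat \<Rightarrow> (nat, 'k) free_alg) set ring" where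
  "A_algebra n \<mu> B = free_poly n Quot A_ideal n \<mu> B"

definition A_scal ::
  "nat \<Rightarrow> (nat \<Rightarrow> nat \<Rightarrow> 'k::field) \<Rightarrow> (nat \<Rightarrow> nat \<Rightarrow> 'k) \<Rightarrow> 'k \<Rightarrow>
   (nat \<Rightarrow> (nat, 'k) free_alg) set" where
  "A_scal n \<mu> B c = A_ideal n \<mu> B +>\<^bsub>free_poly n\<^esub> poly_scal n c"

text \<open>
  The grading with \<open>X\<^sub>i\<close> of degree one and \<open>y\<close> of degree two: a word \<open>w\<close> in the coefficient
  of \<open>y\<^sup>i\<close> has degree \<open>length w + 2 i\<close>.
\<close>

definition A_component ::
  "nat \<Rightarrow> (nat \<Rightarrow> nat \<Rightarrow> 'k::field) \<Rightarrow> (nat \<Rightarrow> nat \<Rightarrow> 'k) \<Rightarrow> nat \<Rightarrow>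
   (nat \<Rightarrow> (nat, 'k) free_alg) set set" where
  "A_component n \<mu> B d =
     (\<lambda>p. A_ideal n \<mu> B +>\<^bsub>free_poly n\<^esub> p) `
       {p \<in> carrier (free_poly n).
          \<forall>i. \<forall>w \<in> Poly_Mapping.keys (up_ring.coeff (free_poly n) p i). length (letters w) + 2 * i = d}"

end

theory Submission
  imports Defs
begin

text \<open>
  Write \<open>r i j\<close> for the relation \<open>X i X j + \<mu> i j X j X i - 2 B i j y\<close>. As some \<open>B a b\<close> is nonzero and
  \<open>2\<close> is invertible, \<open>r a b\<close> expresses \<open>y\<close> through the \<open>X i\<close>, so that \<open>A\<close> is generated in degree one.
  Substituting this expression \<open>y'\<close> for \<open>y\<close> turns every \<open>r i j\<close> into a relation of degree two. The
  only other relations of \<open>A\<close> are the cubic ones \<open>X k y' = y' X k\<close>, and the point of the theorem is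
  that they follow from the quadratic ones.

  Reducing \<open>X i X j X k\<close> to \<open>X k X j X i\<close> by the relations in the two possible orders gives, without
  using that \<open>y\<close> is central, an identity \<open>overlap\<close> between the products of \<open>X i\<close>, \<open>X j\<close>, \<open>X k\<close> with
  \<open>y\<close> on either side. In the skew Clifford algebra, where \<open>y = 1\<close>, it is a linear relation between
  \<open>x i\<close>, \<open>x j\<close> and \<open>x k\<close>. Moving the factors of products past each other shows that this algebra is
  spanned by the \<open>2 ^ n\<close> squarefree products of its generators, and by half as many if one of the
  generators is a linear combination of the others. So full dimension makes the generators
  independent, and the coefficients of the linear relation vanish
  (\<open>full_dimension_overlap_consistent\<close>). With \<open>c k = X k y' - y' X k\<close>, the same overlap in the free
  algebra then reads \<open>B i j c k + \<mu> i j B i k c j + B j k c i = 0\<close> modulo the quadratic relations, for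
  \<open>k\<close> different from \<open>i\<close> and \<open>j\<close>. One nonzero \<open>B a b\<close> therefore makes all \<open>c k\<close> vanish
  (\<open>skew_relations_imply_central\<close>).

  That \<open>A\<close> is graded holds since its defining ideal is generated by homogeneous elements
  (\<open>quotient_graded\<close>). The relations between the classes of the \<open>X i\<close> are determined by the
  substitution of \<open>y'\<close> for \<open>y\<close>: it is multiplicative modulo the quadratic relations because \<open>y'\<close> is
  central modulo them, hence it maps the defining ideal of \<open>A\<close> into the ideal generated by the
  quadratic relations (\<open>substitute_ideal\<close>).
\<close>

section \<open>Free algebras\<close>

lemma free_algebra_simps [simp]:
  "monoid.mult (free_algebra S) = (*)" "monoid.one (free_algebra S) = 1"
  "ring.zero (free_algebra S) = 0" "ring.add (free_algebra S) = (+)"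
  by (simp_all add: free_algebra_def)

lemma free_algebra_carrier:
  "p \<in> carrier (free_algebra S) \<longleftrightarrow> (\<forall>w \<in> Poly_Mapping.keys p. set (letters w) \<subseteq> S)"
  by (simp add: free_algebra_def)

lemma letters_simps [simp]:
  "letters 0 = []" "letters (u + v) = letters u @ letters v"
  by (simp_all add: zero_fmonoid_def plus_fmonoid_def)

lemma free_algebra_add_closed [simp, intro]:
  assumes "p \<in> carrier (free_algebra S)" "q \<in> carrier (free_algebra S)"
  shows "p + q \<in> carrier (free_algebra S)"
  using assms keys_add[of p q] by (fastforce simp: free_algebra_carrier)

lemma free_algebra_mult_closed [simp, intro]:
  assumes "p \<in> carrier (free_algebra S)" "q \<in> carrier (free_algebra S)"
  shows "p * q \<in> carrier (free_algebra S)"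
  using assms keys_mult[of p q] by (fastforce simp: free_algebra_carrier)

lemma free_algebra_uminus_closed [simp, intro]:
  "p \<in> carrier (free_algebra S) \<Longrightarrow> - p \<in> carrier (free_algebra S)"
  by (auto simp: free_algebra_carrier in_keys_iff)

lemma free_algebra_diff_closed [simp, intro]:
  assumes "p \<in> carrier (free_algebra S)" "q \<in> carrier (free_algebra S)"
  shows "p - q \<in> carrier (free_algebra S)"
  using free_algebra_add_closed[OF assms(1) free_algebra_uminus_closed[OF assms(2)]] by simp

lemma free_algebra_closed [simp, intro]:
  "0 \<in> carrier (free_algebra S)"
  "1 \<in> carrier (free_algebra S)"
  "fscal c \<in> carrier (free_algebra S)"
  "s \<in> S \<Longrightarrow> fgen s \<in> carrier (free_algebra S)"
  by (auto simp: free_algebra_carrier fscal_def fgen_def)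

lemma free_algebra_sum_closed [intro]:
  "(\<And>i. i \<in> I \<Longrightarrow> f i \<in> carrier (free_algebra S)) \<Longrightarrow> sum f I \<in> carrier (free_algebra S)"
  by (induction I rule: infinite_finite_induct) auto

lemma ring_free_algebra: "ring (free_algebra S :: ('a, 'k::field) free_alg ring)"
proof (rule ringI)
  show "abelian_group (free_algebra S :: ('a, 'k) free_alg ring)"
  proof (rule abelian_groupI)
    show "\<exists>y\<in>carrier (free_algebra S). y \<oplus>\<^bsub>free_algebra S\<^esub> x = \<zero>\<^bsub>free_algebra S\<^esub>"
      if "x \<in> carrier (free_algebra S)" for x :: "('a, 'k) free_alg"
      using that by (intro bexI[of _ "- x"]) auto
  qed (auto simp: algebra_simps)
  show "Group.monoid (free_algebra S :: ('a, 'k) free_alg ring)"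
    by (rule monoidI) (auto simp: algebra_simps)
qed (auto simp: algebra_simps)

lemma free_algebra_a_inv [simp]:
  assumes "p \<in> carrier (free_algebra S)" shows "\<ominus>\<^bsub>free_algebra S\<^esub> p = - p"
proof -
  interpret ring "free_algebra S" by (rule ring_free_algebra)
  show ?thesis using assms by (intro minus_equality) auto
qed

lemma free_algebra_a_minus [simp]:
  "q \<in> carrier (free_algebra S) \<Longrightarrow> p \<ominus>\<^bsub>free_algebra S\<^esub> q = p - q"
  by (simp add: a_minus_def)

lemma free_algebra_finsum:
  assumes "\<And>i. i \<in> I \<Longrightarrow> f i \<in> carrier (free_algebra S)" and "finite I"
  shows "(\<Oplus>\<^bsub>free_algebra S\<^esub>i\<in>I. f i) = sum f I"
proof -
  interpret ring "free_algebra S" by (rule ring_free_algebra)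
  show ?thesis using assms(2,1) by induction (auto simp: Pi_def)
qed

lemma fscal_simps:
  "fscal 0 = 0" "fscal 1 = 1" "fscal (c + d) = fscal c + fscal d" "fscal (c * d) = fscal c * fscal d"
  "fscal (- c) = - fscal c" "fscal (c - d) = fscal c - fscal d"
  by (simp_all add: fscal_def single_add mult_single single_uminus single_diff)

lemma poly_mapping_sum_monomials:
  "p = (\<Sum>w\<in>Poly_Mapping.keys p. Poly_Mapping.single w (Poly_Mapping.lookup p w))"
proof (rule poly_mapping_eqI)
  fix v
  have "(\<Sum>w\<in>Poly_Mapping.keys p. Poly_Mapping.lookup (Poly_Mapping.single w (Poly_Mapping.lookup p w)) v)
     = (\<Sum>w\<in>Poly_Mapping.keys p. if w = v then Poly_Mapping.lookup p v else 0)"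
    by (intro sum.cong) (auto simp: lookup_single when_def)
  then show "Poly_Mapping.lookup p v = Poly_Mapping.lookup
     (\<Sum>w\<in>Poly_Mapping.keys p. Poly_Mapping.single w (Poly_Mapping.lookup p w)) v"
    by (simp add: lookup_sum in_keys_iff)
qed

lemma monomial_induct [consumes 1, case_names monomial add]:
  assumes p: "p \<in> carrier (free_algebra S)"
    and mono: "\<And>w c. set (letters w) \<subseteq> S \<Longrightarrow> P (Poly_Mapping.single w c)"
    and add: "\<And>p q. p \<in> carrier (free_algebra S) \<Longrightarrow> q \<in> carrier (free_algebra S) \<Longrightarrow>
      P p \<Longrightarrow> P q \<Longrightarrow> P (p + q)"
  shows "P p"
proof -
  have "(\<Sum>w\<in>W. Poly_Mapping.single w (Poly_Mapping.lookup p w)) \<in> carrier (free_algebra S)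
      \<and> P (\<Sum>w\<in>W. Poly_Mapping.single w (Poly_Mapping.lookup p w))"
    if "finite W" "W \<subseteq> Poly_Mapping.keys p" for W
    using that
  proof induction
    case empty
    from mono[of 0 0] show ?case by simp
  next
    case (insert w W)
    then have "set (letters w) \<subseteq> S"
      using p by (auto simp: free_algebra_carrier)
    moreover from this have "Poly_Mapping.single w c \<in> carrier (free_algebra S)" for c
      by (auto simp: free_algebra_carrier)
    ultimately show ?case using insert mono add by auto
  qed
  from this[of "Poly_Mapping.keys p"] show ?thesis
    using poly_mapping_sum_monomials[of p] by simp
qed

lemma single_Word_Cons:
  "Poly_Mapping.single (Word (a # l)) c = fgen a * Poly_Mapping.single (Word l) c"
  by (simp add: fgen_def mult_single plus_fmonoid_def)

text \<open>
  Words are built by adding letters on the left, so closure under left multiplication by generators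
  is enough.
\<close>

lemma free_algebra_induct [consumes 1, case_names scal gen add]:
  assumes p: "p \<in> carrier (free_algebra S)"
    and scal: "\<And>c. P (fscal c)"
    and gen: "\<And>a p. a \<in> S \<Longrightarrow> p \<in> carrier (free_algebra S) \<Longrightarrow> P p \<Longrightarrow> P (fgen a * p)"
    and add: "\<And>p q. p \<in> carrier (free_algebra S) \<Longrightarrow> q \<in> carrier (free_algebra S) \<Longrightarrow>
      P p \<Longrightarrow> P q \<Longrightarrow> P (p + q)"
  shows "P p"
  using p
proof (induction rule: monomial_induct)
  case (monomial w c)
  have "P (Poly_Mapping.single (Word l) c)" if "set l \<subseteq> S" for l
    using that
  proof (induction l)
    case Nil
    from scal[of c] show ?case by (simp add: fscal_def zero_fmonoid_def)
  next
    case (Cons a l)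
    then show ?case
      by (auto simp: single_Word_Cons free_algebra_carrier intro!: gen)
  qed
  from this[of "letters w"] show ?case using monomial by simp
qed (rule add)

lemma in_free_algebra_UNIV [simp]: "p \<in> carrier (free_algebra UNIV)"
  by (simp add: free_algebra_carrier)

lemma fscal_commute: "p * fscal c = fscal c * p"
proof -
  have "p \<in> carrier (free_algebra UNIV)" by simp
  then show ?thesis
    by (induction rule: monomial_induct) (auto simp: fscal_def mult_single algebra_simps)
qed

lemma ideal_free_algebraD:
  assumes "ideal J (free_algebra S)"
  shows "J \<subseteq> carrier (free_algebra S)" and "0 \<in> J"
    and "\<And>p q. p \<in> J \<Longrightarrow> q \<in> J \<Longrightarrow> p + q \<in> J"
    and "\<And>p. p \<in> J \<Longrightarrow> - p \<in> J"
    and "\<And>p q. p \<in> J \<Longrightarrow> q \<in> J \<Longrightarrow> p - q \<in> J"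
    and "\<And>p q. p \<in> J \<Longrightarrow> q \<in> carrier (free_algebra S) \<Longrightarrow> q * p \<in> J"
    and "\<And>p q. p \<in> J \<Longrightarrow> q \<in> carrier (free_algebra S) \<Longrightarrow> p * q \<in> J"
proof -
  interpret ideal J "free_algebra S" by (rule assms)
  show sub: "J \<subseteq> carrier (free_algebra S)" by (rule a_subset)
  show "0 \<in> J" using additive_subgroup.zero_closed[OF additive_subgroup_axioms] by simp
  show add: "p + q \<in> J" if "p \<in> J" "q \<in> J" for p q using additive_subgroup.a_closed[OF additive_subgroup_axioms that] by simp
  show neg: "- p \<in> J" if "p \<in> J" for p
    using additive_subgroup.a_inv_closed[OF additive_subgroup_axioms that] sub that by auto
  show "p - q \<in> J" if "p \<in> J" "q \<in> J" for p q using add[OF that(1) neg[OF that(2)]] by simp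
  show "q * p \<in> J" if "p \<in> J" "q \<in> carrier (free_algebra S)" for p q
    using I_l_closed[OF that] by simp
  show "p * q \<in> J" if "p \<in> J" "q \<in> carrier (free_algebra S)" for p q
    using I_r_closed[OF that] by simp
qed

text \<open>
  The homomorphism of free algebras that is induced by a map between the sets of generators.
\<close>

definition frename :: "('a \<Rightarrow> 'b) \<Rightarrow> ('a, 'k::field) free_alg \<Rightarrow> ('b, 'k) free_alg" where
  "frename f p = (\<Sum>w\<in>Poly_Mapping.keys p.
     Poly_Mapping.single (Word (map f (letters w))) (Poly_Mapping.lookup p w))"

lemma frename_superset:
  assumes "finite W" "Poly_Mapping.keys p \<subseteq> W"
  shows "frename f p =
    (\<Sum>w\<in>W. Poly_Mapping.single (Word (map f (letters w))) (Poly_Mapping.lookup p w))"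
  unfolding frename_def using assms
  by (intro sum.mono_neutral_left) (auto simp: in_keys_iff)

lemma frename_add [simp]: "frename f (p + q) = frename f p + frename f q"
proof -
  let ?W = "Poly_Mapping.keys p \<union> Poly_Mapping.keys q"
  have "Poly_Mapping.keys (p + q) \<subseteq> ?W" by (rule keys_add)
  then show ?thesis
    by (simp add: frename_superset[of ?W] lookup_add single_add sum.distrib)
qed

lemma frename_single:
  "frename f (Poly_Mapping.single w c) = Poly_Mapping.single (Word (map f (letters w))) c"
  by (cases "c = 0") (simp_all add: frename_def)

lemma frename_fscal [simp]: "frename f (fscal c) = fscal c"
  by (simp add: fscal_def frename_single zero_fmonoid_def[symmetric])

lemma frename_fgen [simp]: "frename f (fgen a) = fgen (f a)"
  by (simp add: fgen_def frename_single)

lemma frename_zero [simp]: "frename f 0 = 0"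
  by (simp add: frename_def)

lemma frename_one [simp]: "frename f 1 = 1"
  using frename_fscal[of f 1] by (simp only: fscal_simps)

lemma frename_mult [simp]: "frename f (p * q) = frename f p * frename f q"
proof -
  have "q \<in> carrier (free_algebra UNIV)" by simp
  then have monomial: "frename f (Poly_Mapping.single u c * q)
    = frename f (Poly_Mapping.single u c) * frename f q" for u c
  proof (induction rule: monomial_induct)
    case (monomial v d)
    then show ?case by (simp add: mult_single frename_single plus_fmonoid_def)
  qed (simp add: algebra_simps)
  have "p \<in> carrier (free_algebra UNIV)" by simp
  then show ?thesis
    by (induction rule: monomial_induct) (simp_all add: monomial algebra_simps)
qed

lemma frename_uminus [simp]: "frename f (- p) = - frename f p"
proof -
  have "frename f (- p) + frename f p = frename f (- p + p)" by (simp only: frename_add)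
  then show ?thesis by (simp add: eq_neg_iff_add_eq_0)
qed

lemma frename_diff [simp]: "frename f (p - q) = frename f p - frename f q"
  using frename_add[of f p "- q"] by simp

lemma frename_closed:
  assumes "p \<in> carrier (free_algebra S)" "f ` S \<subseteq> T"
  shows "frename f p \<in> carrier (free_algebra T)"
  using assms(1) by (induction rule: free_algebra_induct) (use assms(2) in auto)

lemma frename_inverse:
  assumes "p \<in> carrier (free_algebra S)" "\<And>s. s \<in> S \<Longrightarrow> g (f s) = s"
  shows "frename g (frename f p) = p"
  using assms(1) by (induction rule: free_algebra_induct) (use assms(2) in auto)

section \<open>Graded rings and homogeneous ideals\<close>

lemma (in ideal) quotient_carrier: "carrier (R Quot I) = (+>) I ` carrier R"
  by (auto simp: FactRing_def A_RCOSETS_def')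

lemma (in ideal) coset_eq_zero_iff:
  assumes p: "p \<in> carrier R"
  shows "I +> p = \<zero>\<^bsub>R Quot I\<^esub> \<longleftrightarrow> p \<in> I"
proof -
  have "\<zero>\<^bsub>R Quot I\<^esub> = I" by (simp add: FactRing_def)
  then show ?thesis using a_rcos_const a_rcos_self[OF p] by auto
qed

text \<open>
  A grading is described by its projections and not only by its components, because projections
  pass to quotients and turn the uniqueness of decompositions into a calculation.
\<close>

locale graded_ring = ring R for R (structure) +
  fixes H :: "nat \<Rightarrow> 'a set" and pr :: "nat \<Rightarrow> 'a \<Rightarrow> 'a"
  assumes H_subgroup: "additive_subgroup (H d) R"
    and one_H: "\<one> \<in> H 0"
    and mult_H: "a \<in> H d \<Longrightarrow> b \<in> H e \<Longrightarrow> a \<otimes> b \<in> H (d + e)"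
    and pr_H: "a \<in> carrier R \<Longrightarrow> pr d a \<in> H d"
    and pr_add: "a \<in> carrier R \<Longrightarrow> b \<in> carrier R \<Longrightarrow> pr d (a \<oplus> b) = pr d a \<oplus> pr d b"
    and pr_same: "a \<in> H d \<Longrightarrow> pr d a = a"
    and pr_other: "a \<in> H e \<Longrightarrow> d \<noteq> e \<Longrightarrow> pr d a = \<zero>"
    and pr_sum: "a \<in> carrier R \<Longrightarrow> \<exists>N. (\<forall>d>N. pr d a = \<zero>) \<and> a = (\<Oplus>d\<in>{..N}. pr d a)"
begin

lemma H_carrier: "a \<in> H d \<Longrightarrow> a \<in> carrier R"
  using additive_subgroup.a_subset[OF H_subgroup] by blast

lemma pr_closed [simp]: "a \<in> carrier R \<Longrightarrow> pr d a \<in> carrier R"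
  using pr_H H_carrier by blast

lemma pr_zero [simp]: "pr d \<zero> = \<zero>"
  by (intro pr_same additive_subgroup.zero_closed H_subgroup)

lemma pr_finsum:
  assumes "finite I" "f \<in> I \<rightarrow> carrier R"
  shows "pr d (\<Oplus>i\<in>I. f i) = (\<Oplus>i\<in>I. pr d (f i))"
  using assms by induction (auto simp: pr_add Pi_def)

text \<open>
  Applying the projection of degree \<open>d\<close> to a decomposition of \<open>a\<close> leaves only its component of
  degree \<open>d\<close>.
\<close>

lemma unique_decomposition:
  assumes a: "a \<in> carrier R"
  shows "\<exists>!f. (\<forall>d. f d \<in> H d) \<and> finite {d. f d \<noteq> \<zero>} \<and> a = (\<Oplus>d\<in>{d. f d \<noteq> \<zero>}. f d)"
proof (rule ex1I[of _ "\<lambda>d. pr d a"])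
  from pr_sum[OF a] obtain N where N: "\<forall>d>N. pr d a = \<zero>" "a = (\<Oplus>d\<in>{..N}. pr d a)"
    by blast
  have sub: "{d. pr d a \<noteq> \<zero>} \<subseteq> {..N}" using N(1) by (auto simp: not_less[symmetric])
  have "(\<Oplus>d\<in>{..N}. pr d a) = (\<Oplus>d\<in>{d. pr d a \<noteq> \<zero>}. pr d a)"
    using sub a by (intro add.finprod_mono_neutral_cong_right) auto
  then show "(\<forall>d. pr d a \<in> H d) \<and> finite {d. pr d a \<noteq> \<zero>} \<and> a = (\<Oplus>d\<in>{d. pr d a \<noteq> \<zero>}. pr d a)"
    using N(2) pr_H[OF a] finite_subset[OF sub] by simp
next
  fix f
  assume f: "(\<forall>d. f d \<in> H d) \<and> finite {d. f d \<noteq> \<zero>} \<and> a = (\<Oplus>d\<in>{d. f d \<noteq> \<zero>}. f d)"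
  then have carr: "f e \<in> carrier R" for e using H_carrier by blast
  show "f = (\<lambda>d. pr d a)"
  proof
    fix d
    have "pr d a = pr d (\<Oplus>e\<in>{e. f e \<noteq> \<zero>}. f e)" using f by simp
    also have "\<dots> = (\<Oplus>e\<in>{e. f e \<noteq> \<zero>}. pr d (f e))"
      using f carr by (intro pr_finsum) auto
    also have "\<dots> = (\<Oplus>e\<in>{e. f e \<noteq> \<zero>}. if d = e then f e else \<zero>)"
      using f carr by (intro finsum_cong') (auto simp: pr_same intro: pr_other)
    also have "\<dots> = f d"
    proof (cases "f d = \<zero>")
      case True
      then have "(\<Oplus>e\<in>{e. f e \<noteq> \<zero>}. if d = e then f e else \<zero>) = (\<Oplus>e\<in>{e. f e \<noteq> \<zero>}. \<zero>)"
        by (intro finsum_cong') auto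
      then show ?thesis using True by simp
    next
      case False
      then show ?thesis using f carr by (intro finsum_singleton) auto
    qed
    finally show "f d = pr d a" ..
  qed
qed

lemma additive_subgroup_finsum_closed:
  assumes "additive_subgroup T R" "finite I" "\<And>i. i \<in> I \<Longrightarrow> f i \<in> T"
  shows "(\<Oplus>i\<in>I. f i) \<in> T"
proof -
  interpret T: additive_subgroup T R by (rule assms(1))
  have "f i \<in> carrier R" if "i \<in> I" for i using assms(3)[OF that] T.a_subset by blast
  with assms(2,3) show ?thesis
    by induction (auto simp: Pi_def intro: T.a_closed T.zero_closed)
qed

text \<open>
  A component of a product is a sum of products of components, and one factor of each of these
  products lies in the ideal.
\<close>

lemma pr_mult_in_ideal:
  assumes I: "ideal I R" and a: "a \<in> carrier R" and b: "b \<in> carrier R"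
    and *: "(\<forall>e. pr e a \<in> I) \<or> (\<forall>e. pr e b \<in> I)"
  shows "pr d (a \<otimes> b) \<in> I"
proof -
  interpret I: ideal I R by (rule I)
  have sub: "additive_subgroup I R" by (rule I.additive_subgroup_axioms)
  obtain N where N: "a = (\<Oplus>e\<in>{..N}. pr e a)" using pr_sum[OF a] by blast
  obtain M where M: "b = (\<Oplus>e\<in>{..M}. pr e b)" using pr_sum[OF b] by blast
  have homogeneous_product: "pr d (pr e a \<otimes> pr f b) \<in> I" for e f
  proof (cases "d = e + f")
    case True
    have "pr e a \<otimes> pr f b \<in> I"
      using * a b by (auto intro: I.I_l_closed I.I_r_closed)
    then show ?thesis using True a b by (simp add: pr_same mult_H pr_H)
  next
    case False
    then have "pr d (pr e a \<otimes> pr f b) = \<zero>"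
      using a b by (intro pr_other[of _ "e + f"] mult_H pr_H) auto
    then show ?thesis using additive_subgroup.zero_closed[OF sub] by simp
  qed
  have "a \<otimes> b = (\<Oplus>e\<in>{..N}. pr e a \<otimes> b)"
    by (subst N, subst finsum_ldistr) (use a b in auto)
  also have "\<dots> = (\<Oplus>e\<in>{..N}. \<Oplus>f\<in>{..M}. pr e a \<otimes> pr f b)"
  proof (intro finsum_cong')
    fix e
    show "pr e a \<otimes> b = (\<Oplus>f\<in>{..M}. pr e a \<otimes> pr f b)"
      by (subst M, subst finsum_rdistr) (use a b in auto)
  qed (use a b in auto)
  finally have "pr d (a \<otimes> b) = (\<Oplus>e\<in>{..N}. pr d (\<Oplus>f\<in>{..M}. pr e a \<otimes> pr f b))"
    using a b by (simp add: pr_finsum Pi_def)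
  also have "\<dots> = (\<Oplus>e\<in>{..N}. \<Oplus>f\<in>{..M}. pr d (pr e a \<otimes> pr f b))"
    using a b by (simp add: pr_finsum Pi_def)
  also have "\<dots> \<in> I"
    by (intro additive_subgroup_finsum_closed[OF sub] homogeneous_product) auto
  finally show ?thesis .
qed

text \<open>
  The elements all of whose components lie in the ideal form an ideal themselves, and it contains
  the homogeneous generators.
\<close>

lemma homogeneous_ideal:
  assumes Q: "Q \<subseteq> (\<Union>d. H d)" and p: "p \<in> Idl Q"
  shows "pr d p \<in> Idl Q"
proof -
  have Qc: "Q \<subseteq> carrier R" using Q H_carrier by blast
  have I: "ideal (Idl Q) R" by (rule genideal_ideal[OF Qc])
  interpret I: ideal "Idl Q" R by (rule I)
  define J where "J = {p \<in> carrier R. \<forall>d. pr d p \<in> Idl Q}"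
  have inv: "pr d (\<ominus> a) = \<ominus> pr d a" if a: "a \<in> carrier R" for a d
  proof -
    have "pr d (\<ominus> a) \<oplus> pr d a = pr d (\<ominus> a \<oplus> a)" using a by (simp add: pr_add)
    also have "\<dots> = \<zero>" using a by (simp add: l_neg)
    finally show ?thesis using a by (simp add: minus_equality)
  qed
  have "ideal J R"
  proof (rule idealI)
    show "ring R" by (rule ring_axioms)
    show "subgroup J (add_monoid R)"
    proof (rule add.subgroupI)
      have "\<zero> \<in> J" by (simp add: J_def I.zero_closed)
      then show "J \<noteq> {}" by blast
      show "\<ominus> a \<in> J" if "a \<in> J" for a
        using that inv by (simp add: J_def I.a_inv_closed)
      show "a \<oplus> b \<in> J" if "a \<in> J" "b \<in> J" for a b
        using that by (simp add: J_def pr_add I.a_closed)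
    qed (auto simp: J_def)
  qed (auto simp: J_def intro!: pr_mult_in_ideal[OF I])
  moreover have "Q \<subseteq> J"
  proof
    fix q assume q: "q \<in> Q"
    then obtain e where e: "q \<in> H e" using Q by blast
    have "pr d q \<in> Idl Q" for d
      using genideal_self[OF Qc] q pr_same[OF e] pr_other[OF e, of d] I.zero_closed
      by (cases "d = e") auto
    then show "q \<in> J" using q Qc by (auto simp: J_def)
  qed
  ultimately have "Idl Q \<subseteq> J" by (rule genideal_minimal)
  then show ?thesis using p by (auto simp: J_def)
qed

text \<open>
  The projections respect the cosets of a homogeneous ideal, so they can be computed on
  representatives; \<open>SOME\<close> picks one.
\<close>

lemma quotient_graded:
  assumes Q: "Q \<subseteq> (\<Union>d. H d)"
  defines "I \<equiv> Idl Q"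
  shows "graded_ring (R Quot I) (\<lambda>d. (+>) I ` H d)
    (\<lambda>d a. I +> pr d (SOME p. p \<in> carrier R \<and> I +> p = a))"
proof -
  have Qc: "Q \<subseteq> carrier R" using Q H_carrier by blast
  interpret I: ideal I R unfolding I_def by (rule genideal_ideal[OF Qc])
  interpret A: ring "R Quot I" by (rule I.quotient_is_ring)
  interpret \<pi>: ring_hom_ring R "R Quot I" "(+>) I" by (rule I.rcos_ring_hom_ring)
  define pq where "pq d a = I +> pr d (SOME p. p \<in> carrier R \<and> I +> p = a)" for d a
  have surj: "\<exists>p\<in>carrier R. a = I +> p" if "a \<in> carrier (R Quot I)" for a
    using that I.quotient_carrier by blast
  have eq_iff: "I +> p = I +> q \<longleftrightarrow> p \<ominus> q \<in> I" if "p \<in> carrier R" "q \<in> carrier R" for p q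
    using quotient_eq_iff_same_a_r_cos[OF I.ideal_axioms that] by simp
  have pq: "pq d (I +> p) = I +> pr d p" if p: "p \<in> carrier R" for d p
  proof -
    define q where "q = (SOME q. q \<in> carrier R \<and> I +> q = I +> p)"
    have q: "q \<in> carrier R" "I +> q = I +> p"
      using someI[of "\<lambda>q. q \<in> carrier R \<and> I +> q = I +> p" p] p
      unfolding q_def by blast+
    have d: "q \<ominus> p \<in> I" using q p eq_iff by simp
    then have "pr d (q \<ominus> p) \<in> I" unfolding I_def by (rule homogeneous_ideal[OF Q])
    then have "I +> pr d (q \<ominus> p) = \<zero>\<^bsub>R Quot I\<^esub>"
      using q p by (simp add: I.coset_eq_zero_iff)
    moreover have "pr d q = pr d (q \<ominus> p) \<oplus> pr d p"
      using q p pr_add[of "q \<ominus> p" p d] by (simp add: a_minus_def a_assoc l_neg)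
    ultimately have "I +> pr d q = I +> pr d p" using q p by simp
    then show ?thesis by (simp add: pq_def q_def)
  qed
  have sub: "additive_subgroup ((+>) I ` H d) (R Quot I)" for d
    using \<pi>.img_is_add_subgroup[OF additive_subgroup.a_subgroup[OF H_subgroup]]
    by (rule additive_subgroup.intro)
  have "graded_ring (R Quot I) (\<lambda>d. (+>) I ` H d) pq"
  proof (intro graded_ring.intro graded_ring_axioms.intro A.ring_axioms sub)
    show "\<one>\<^bsub>R Quot I\<^esub> \<in> (+>) I ` H 0"
      using one_H \<pi>.hom_one by (metis imageI)
  next
    fix a b d e assume "a \<in> (+>) I ` H d" "b \<in> (+>) I ` H e"
    then show "a \<otimes>\<^bsub>R Quot I\<^esub> b \<in> (+>) I ` H (d + e)"
      using mult_H H_carrier by (auto simp flip: \<pi>.hom_mult)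
  next
    fix a d assume "a \<in> carrier (R Quot I)"
    then show "pq d a \<in> (+>) I ` H d" using surj pq pr_H by fastforce
  next
    fix a b d assume "a \<in> carrier (R Quot I)" "b \<in> carrier (R Quot I)"
    then obtain p q where "a = I +> p" "b = I +> q" "p \<in> carrier R" "q \<in> carrier R"
      using surj by metis
    then show "pq d (a \<oplus>\<^bsub>R Quot I\<^esub> b) = pq d a \<oplus>\<^bsub>R Quot I\<^esub> pq d b"
      by (simp add: pq pr_add flip: \<pi>.hom_add)
  next
    fix a d assume "a \<in> (+>) I ` H d"
    then show "pq d a = a" using pq H_carrier pr_same by auto
  next
    fix a d e assume "a \<in> (+>) I ` H e" "d \<noteq> (e::nat)"
    then show "pq d a = \<zero>\<^bsub>R Quot I\<^esub>" using pq H_carrier pr_other \<pi>.hom_zero by auto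
  next
    fix a assume "a \<in> carrier (R Quot I)"
    then obtain p where p: "p \<in> carrier R" "a = I +> p" using surj by blast
    from pr_sum[OF p(1)] obtain N where N: "\<forall>d>N. pr d p = \<zero>" "p = (\<Oplus>d\<in>{..N}. pr d p)"
      by blast
    have "a = I +> (\<Oplus>d\<in>{..N}. pr d p)" using p N by simp
    also have "\<dots> = (\<Oplus>\<^bsub>R Quot I\<^esub>d\<in>{..N}. I +> pr d p)"
      using p by (subst \<pi>.hom_finsum) (auto simp: comp_def)
    also have "\<dots> = (\<Oplus>\<^bsub>R Quot I\<^esub>d\<in>{..N}. pq d a)"
      using p by (simp add: pq)
    finally have "a = (\<Oplus>\<^bsub>R Quot I\<^esub>d\<in>{..N}. pq d a)" .
    moreover have "pq d a = \<zero>\<^bsub>R Quot I\<^esub>" if "d > N" for d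
      unfolding p(2) pq[OF p(1)] using N(1) that \<pi>.hom_zero by simp
    ultimately show "\<exists>N. (\<forall>d>N. pq d a = \<zero>\<^bsub>R Quot I\<^esub>) \<and> a = (\<Oplus>\<^bsub>R Quot I\<^esub>d\<in>{..N}. pq d a)"
      by blast
  qed
  then show ?thesis by (simp add: pq_def[abs_def])
qed

end

section \<open>Spanning by squarefree products\<close>

context ring
begin

text \<open>
  Every generator is used at most once and in a fixed position. So each of them doubles the number
  of products, and one generator less halves the bound on the dimension.
\<close>

fun squarefree_products :: "'a list \<Rightarrow> 'a list" where
  "squarefree_products [] = [\<one>]"
| "squarefree_products (z # zs) =
     squarefree_products zs @ map (\<lambda>m. z \<otimes> m) (squarefree_products zs)"

lemma length_squarefree_products: "length (squarefree_products zs) = 2 ^ length zs"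
  by (induction zs) auto

lemma squarefree_products_carrier:
  "set zs \<subseteq> carrier R \<Longrightarrow> set (squarefree_products zs) \<subseteq> carrier R"
  by (induction zs) auto

lemma one_in_squarefree_products: "\<one> \<in> set (squarefree_products zs)"
  by (induction zs) auto

context
  fixes K assumes K: "subfield K R"
    and central: "\<And>k a. k \<in> K \<Longrightarrow> a \<in> carrier R \<Longrightarrow> k \<otimes> a = a \<otimes> k"
begin

lemma K_carrier: "k \<in> K \<Longrightarrow> k \<in> carrier R"
  using subfieldE(3)[OF K] by blast

lemma Span_Cons_iff: "w \<in> Span K (u # Us) \<longleftrightarrow> (\<exists>k\<in>K. \<exists>v\<in>Span K Us. w = k \<otimes> u \<oplus> v)"
  by (simp add: line_extension_mem_iff)

lemma mult_Span:
  assumes "set Us \<subseteq> carrier R" "set Vs \<subseteq> carrier R" "x \<in> carrier R"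
    and "\<And>u. u \<in> set Us \<Longrightarrow> x \<otimes> u \<in> Span K Vs" and "w \<in> Span K Us"
  shows "x \<otimes> w \<in> Span K Vs"
  using assms(1,4,5)
proof (induction Us arbitrary: w)
  case Nil
  then have "w = \<zero>" by simp
  then show ?case using assms(3) Span_subgroup_props(2)[OF K assms(2)] by (simp del: Span.simps)
next
  case (Cons u Us)
  from Cons.prems(3)[unfolded Span_Cons_iff]
  obtain k v where w: "k \<in> K" "v \<in> Span K Us" "w = k \<otimes> u \<oplus> v" by blast
  have Us: "set Us \<subseteq> carrier R" using Cons.prems(1) by simp
  have v: "v \<in> carrier R" using w(2) Span_subgroup_props(1)[OF K Us] by blast
  have u: "u \<in> carrier R" using Cons.prems(1) by simp
  have "x \<otimes> (k \<otimes> u) = (k \<otimes> x) \<otimes> u"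
    using assms(3) u K_carrier[OF w(1)] central[OF w(1) assms(3)] by (simp add: m_assoc)
  then have "x \<otimes> w = k \<otimes> (x \<otimes> u) \<oplus> x \<otimes> v"
    using w u v assms(3) K_carrier[OF w(1)] by (simp add: r_distr m_assoc)
  moreover have "k \<otimes> (x \<otimes> u) \<in> Span K Vs"
    by (rule Span_smult_closed[OF K assms(2) w(1)]) (simp add: Cons.prems(2) del: Span.simps)
  moreover have "x \<otimes> v \<in> Span K Vs"
    by (rule Cons.IH[OF Us Cons.prems(2) w(2)]) simp
  ultimately show ?case using Span_subgroup_props(3)[OF K assms(2)] by (simp del: Span.simps)
qed

text \<open>
  To multiply \<open>z m\<close> by a later generator \<open>x\<close>, move \<open>x\<close> past \<open>z\<close>: up to scalars this gives
  \<open>z (x m)\<close> and \<open>m\<close>, where \<open>x m\<close> is covered by the induction hypothesis for the shorter list.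
  The generator \<open>z\<close> itself is put in front of \<open>m\<close>, or merges with a leading \<open>z\<close> into a scalar.
\<close>

lemma generator_mult_squarefree_products:
  assumes zs: "set zs \<subseteq> carrier R"
    and rel: "\<And>u v. u \<in> set zs \<Longrightarrow> v \<in> set zs \<Longrightarrow> \<exists>k\<in>K. \<exists>l\<in>K. u \<otimes> v = k \<otimes> (v \<otimes> u) \<oplus> l"
    and sq: "\<And>u. u \<in> set zs \<Longrightarrow> u \<otimes> u \<in> K"
    and x: "x \<in> set zs" and w: "w \<in> Span K (squarefree_products zs)"
  shows "x \<otimes> w \<in> Span K (squarefree_products zs)"
  using assms
proof (induction zs arbitrary: x w)
  case (Cons z zs)
  let ?M = "squarefree_products zs"
  let ?N = "squarefree_products (z # zs)"
  have M: "set ?M \<subseteq> carrier R" and N: "set ?N \<subseteq> carrier R"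
    using Cons.prems(1) squarefree_products_carrier[of zs]
      squarefree_products_carrier[of "z # zs"] by (simp_all del: squarefree_products.simps)
  have z: "z \<in> carrier R" and x: "x \<in> carrier R" using Cons.prems(1,4) by auto
  have base: "m \<in> Span K ?N" if "m \<in> set ?N" for m
    using that Span_base_incl[OF K N] by blast
  have mono: "m \<in> Span K ?N" if "m \<in> Span K ?M" for m
    using that mono_Span_sublist[OF K, of ?M ?N] N by auto
  have z_Span: "z \<otimes> m \<in> Span K ?N" if "m \<in> Span K ?M" for m
    by (rule mult_Span[OF M N z _ that]) (rule base, simp)
  show ?case
  proof (rule mult_Span[OF N N x _ Cons.prems(5)])
    fix u assume "u \<in> set ?N"
    then consider "u \<in> set ?M" | m where "m \<in> set ?M" "u = z \<otimes> m" by auto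
    then show "x \<otimes> u \<in> Span K ?N"
    proof cases
      case 1
      show ?thesis
      proof (cases "x = z")
        case True
        then show ?thesis using 1 by (intro base) auto
      next
        case False
        then have "x \<otimes> u \<in> Span K ?M"
          using Cons.prems 1 Span_base_incl[OF K M] by (intro Cons.IH) auto
        then show ?thesis by (rule mono)
      qed
    next
      case 2
      have m: "m \<in> carrier R" using 2 M by blast
      have mM: "m \<in> Span K ?M" using 2 Span_base_incl[OF K M] by blast
      show ?thesis
      proof (cases "x = z")
        case True
        have "x \<otimes> u = (z \<otimes> z) \<otimes> m" using True 2 z m by (simp add: m_assoc)
        also have "\<dots> \<in> Span K ?N"
          using Cons.prems(3) by (intro Span_smult_closed[OF K N] mono mM) auto
        finally show ?thesis .
      next
        case False
        then have xzs: "x \<in> set zs" using Cons.prems(4) by simp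
        obtain k l where kl: "k \<in> K" "l \<in> K" "x \<otimes> z = k \<otimes> (z \<otimes> x) \<oplus> l"
          using Cons.prems(2)[of x z] Cons.prems(4) by auto
        have "x \<otimes> u = (k \<otimes> (z \<otimes> x) \<oplus> l) \<otimes> m"
          using 2 x z m by (simp add: m_assoc flip: kl(3))
        also have "\<dots> = k \<otimes> (z \<otimes> (x \<otimes> m)) \<oplus> l \<otimes> m"
          using x z m kl(1,2) K_carrier by (simp add: l_distr m_assoc)
        also have "\<dots> \<in> Span K ?N"
        proof (rule Span_subgroup_props(3)[OF K N])
          have "x \<otimes> m \<in> Span K ?M"
            using Cons.prems xzs mM by (intro Cons.IH) auto
          then show "k \<otimes> (z \<otimes> (x \<otimes> m)) \<in> Span K ?N"
            by (rule Span_smult_closed[OF K N kl(1) z_Span])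
          show "l \<otimes> m \<in> Span K ?N"
            by (rule Span_smult_closed[OF K N kl(2) mono[OF mM]])
        qed
        finally show ?thesis .
      qed
    qed
  qed
qed simp

text \<open>
  By linearity the factor may be any linear combination of the generators in the list. This is how
  a generator that depends linearly on the others is absorbed by them.
\<close>

lemma Span_mult_squarefree_products:
  assumes zs: "set zs \<subseteq> carrier R"
    and rel: "\<And>u v. u \<in> set zs \<Longrightarrow> v \<in> set zs \<Longrightarrow> \<exists>k\<in>K. \<exists>l\<in>K. u \<otimes> v = k \<otimes> (v \<otimes> u) \<oplus> l"
    and sq: "\<And>u. u \<in> set zs \<Longrightarrow> u \<otimes> u \<in> K"
    and x: "x \<in> Span K zs" and w: "w \<in> Span K (squarefree_products zs)"
  shows "x \<otimes> w \<in> Span K (squarefree_products zs)"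
proof -
  let ?M = "squarefree_products zs"
  have M: "set ?M \<subseteq> carrier R" by (rule squarefree_products_carrier[OF zs])
  have w': "w \<in> carrier R" using w Span_subgroup_props(1)[OF K M] by blast
  have "x \<otimes> w \<in> Span K ?M" if "set us \<subseteq> set zs" "x \<in> Span K us" for us x
    using that
  proof (induction us arbitrary: x)
    case Nil
    then show ?case using Span_subgroup_props(2)[OF K M] w' by simp
  next
    case (Cons u us)
    from Cons.prems(2)[unfolded Span_Cons_iff]
    obtain k v where kv: "k \<in> K" "v \<in> Span K us" "x = k \<otimes> u \<oplus> v" by blast
    have us: "set us \<subseteq> carrier R" and u: "u \<in> carrier R" using Cons.prems(1) zs by auto
    have v: "v \<in> carrier R" using kv(2) Span_subgroup_props(1)[OF K us] by blast
    have "x \<otimes> w = k \<otimes> (u \<otimes> w) \<oplus> v \<otimes> w"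
      using kv u v w' K_carrier by (simp add: l_distr m_assoc)
    also have "\<dots> \<in> Span K ?M"
    proof (rule Span_subgroup_props(3)[OF K M])
      have "u \<in> set zs" using Cons.prems(1) by simp
      have "u \<otimes> w \<in> Span K ?M"
      proof (rule generator_mult_squarefree_products[OF zs])
        show "\<exists>k\<in>K. \<exists>l\<in>K. a \<otimes> b = k \<otimes> (b \<otimes> a) \<oplus> l" if "a \<in> set zs" "b \<in> set zs" for a b
          using that by (rule rel)
        show "a \<otimes> a \<in> K" if "a \<in> set zs" for a using that by (rule sq)
        show "u \<in> set zs" by fact
        show "w \<in> Span K ?M" by (rule w)
      qed
      then show "k \<otimes> (u \<otimes> w) \<in> Span K ?M"
        by (rule Span_smult_closed[OF K M kv(1)])
      show "v \<otimes> w \<in> Span K ?M"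
        using Cons.prems(1) by (intro Cons.IH kv(2)) simp
    qed
    finally show ?case .
  qed
  from this[OF subset_refl x] show ?thesis .
qed

end

text \<open>
  Dropping each vector that lies in the span of the vectors after it turns a spanning list into a
  basis.
\<close>

lemma dimension_le_length:
  assumes K: "subfield K R" and Us: "set Us \<subseteq> carrier R" and dim: "dimension n K (Span K Us)"
  shows "n \<le> length Us"
proof -
  have "\<exists>Vs. independent K Vs \<and> Span K Vs = Span K Us \<and> length Vs \<le> length Us"
    using Us
  proof (induction Us)
    case Nil
    then show ?case by (intro exI[of _ "[]"]) simp
  next
    case (Cons u Us)
    then obtain Vs where Vs: "independent K Vs" "Span K Vs = Span K Us" "length Vs \<le> length Us"
      by auto
    show ?case
    proof (cases "u \<in> Span K Us")
      case True
      then have "Span K (u # Us) = Span K Us"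
        using mono_Span_subset[OF K, of "u # Us" Us] Span_base_incl[OF K, of Us]
          mono_Span[OF K, of Us u] Cons.prems by (simp add: subset_antisym del: Span.simps)
      then show ?thesis using Vs by (intro exI[of _ Vs]) simp
    next
      case False
      then have "independent K (u # Vs)"
        using li_Cons[of u K Vs] Cons.prems Vs by (simp del: Span.simps)
      moreover have "Span K (u # Vs) = Span K (u # Us)" using Vs(2) by simp
      ultimately show ?thesis using Vs(3) by (intro exI[of _ "u # Vs"]) simp
    qed
  qed
  then obtain Vs where "independent K Vs" "Span K Vs = Span K Us" "length Vs \<le> length Us" by blast
  moreover from this have "dimension (length Vs) K (Span K Us)"
    by (intro dimensionI[OF K])
  ultimately show ?thesis using dimension_is_inj[OF K dim] by simp
qed

end

section \<open>Polynomials over a free algebra\<close>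

lemma UP_ring_free_algebra: "UP_ring (free_algebra S)"
  by (simp add: UP_ring.intro ring_free_algebra)

lemma ring_UP_free_algebra: "ring (UP (free_algebra S))"
  by (rule UP_ring.UP_ring[OF UP_ring_free_algebra])

lemma UP_carrier_iff:
  "p \<in> carrier (UP (free_algebra S)) \<longleftrightarrow>
     (\<forall>i. p i \<in> carrier (free_algebra S)) \<and> (\<exists>N. \<forall>i>N. p i = 0)"
  by (auto simp: UP_def up_def bound_def Pi_def)

lemma UP_coeff [simp]: "p \<in> carrier (UP (free_algebra S)) \<Longrightarrow> up_ring.coeff (UP (free_algebra S)) p = p"
  by (simp add: UP_def)

lemma UP_monom:
  "a \<in> carrier (free_algebra S) \<Longrightarrow>
    up_ring.monom (UP (free_algebra S)) a k = (\<lambda>i. if i = k then a else 0)"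
  by (simp add: UP_def fun_eq_iff)

lemma UP_monom_closed [simp]:
  "a \<in> carrier (free_algebra S) \<Longrightarrow> up_ring.monom (UP (free_algebra S)) a k \<in> carrier (UP (free_algebra S))"
  by (rule UP_ring.monom_closed[OF UP_ring_free_algebra])

lemma UP_zero: "\<zero>\<^bsub>UP (free_algebra S)\<^esub> = (\<lambda>i. 0)"
  by (simp add: UP_def)

lemma UP_one: "\<one>\<^bsub>UP (free_algebra S)\<^esub> = (\<lambda>i. if i = 0 then 1 else 0)"
  by (simp add: UP_def fun_eq_iff)

lemma UP_add:
  "p \<in> carrier (UP (free_algebra S)) \<Longrightarrow> q \<in> carrier (UP (free_algebra S)) \<Longrightarrow>
    p \<oplus>\<^bsub>UP (free_algebra S)\<^esub> q = (\<lambda>i. p i + q i)"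
  by (simp add: UP_def)

lemma UP_mult:
  assumes p: "p \<in> carrier (UP (free_algebra S))" and q: "q \<in> carrier (UP (free_algebra S))"
  shows "p \<otimes>\<^bsub>UP (free_algebra S)\<^esub> q = (\<lambda>k. \<Sum>i\<le>k. p i * q (k - i))"
proof
  fix k
  have "(\<Oplus>\<^bsub>free_algebra S\<^esub>i\<in>{..k}. p i * q (k - i)) = (\<Sum>i\<le>k. p i * q (k - i))"
    using p q by (intro free_algebra_finsum) (auto simp: UP_carrier_iff)
  then show "(p \<otimes>\<^bsub>UP (free_algebra S)\<^esub> q) k = (\<Sum>i\<le>k. p i * q (k - i))"
    using p q by (simp add: UP_def)
qed

lemma UP_a_inv:
  assumes p: "p \<in> carrier (UP (free_algebra S))"
  shows "\<ominus>\<^bsub>UP (free_algebra S)\<^esub> p = (\<lambda>i. - p i)"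
proof -
  interpret P: ring "UP (free_algebra S)" by (rule ring_UP_free_algebra)
  have q: "(\<lambda>i. - p i) \<in> carrier (UP (free_algebra S))" using p by (auto simp: UP_carrier_iff)
  show ?thesis
    using p q by (intro P.minus_equality) (auto simp: UP_add UP_zero)
qed

lemma UP_finsum:
  assumes "finite I" "f \<in> I \<rightarrow> carrier (UP (free_algebra S))"
  shows "(\<Oplus>\<^bsub>UP (free_algebra S)\<^esub>d\<in>I. f d) = (\<lambda>i. \<Sum>d\<in>I. f d i)"
proof -
  interpret P: ring "UP (free_algebra S)" by (rule ring_UP_free_algebra)
  show ?thesis using assms
  proof induction
    case (insert d I)
    have "(\<Oplus>\<^bsub>UP (free_algebra S)\<^esub>e\<in>I. f e) \<in> carrier (UP (free_algebra S))"
      using insert.prems by (intro P.finsum_closed) auto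
    then show ?case using insert by (simp add: UP_add Pi_def)
  qed (simp add: UP_zero)
qed

lift_definition restrict_words ::
  "('a fmonoid \<Rightarrow> bool) \<Rightarrow> ('a, 'k::field) free_alg \<Rightarrow> ('a, 'k) free_alg"
  is "\<lambda>Q p w. if Q w then p w else 0"
  by (rule finite_subset[rotated], assumption) auto

lemma lookup_restrict_words:
  "Poly_Mapping.lookup (restrict_words Q p) w = (if Q w then Poly_Mapping.lookup p w else 0)"
  by transfer simp

lemma keys_restrict_words:
  "Poly_Mapping.keys (restrict_words Q p) = {w \<in> Poly_Mapping.keys p. Q w}"
  by (auto simp: in_keys_iff lookup_restrict_words split: if_splits)

lemma restrict_words_closed [simp]:
  "p \<in> carrier (free_algebra S) \<Longrightarrow> restrict_words Q p \<in> carrier (free_algebra S)"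
  by (simp add: free_algebra_carrier keys_restrict_words)

lemma restrict_words_zero [simp]: "restrict_words Q 0 = 0"
  by (rule poly_mapping_eqI) (simp add: lookup_restrict_words)

text \<open>
  The variable of the polynomial ring has degree two and the letters have degree one.
\<close>

definition free_poly_component :: "'a set \<Rightarrow> nat \<Rightarrow> (nat \<Rightarrow> ('a, 'k::field) free_alg) set" where
  "free_poly_component S d = {p \<in> carrier (UP (free_algebra S)).
     \<forall>i. \<forall>w \<in> Poly_Mapping.keys (p i). length (letters w) + 2 * i = d}"

definition free_poly_projection ::
  "nat \<Rightarrow> (nat \<Rightarrow> ('a, 'k::field) free_alg) \<Rightarrow> nat \<Rightarrow> ('a, 'k) free_alg" where
  "free_poly_projection d p = (\<lambda>i. restrict_words (\<lambda>w. length (letters w) + 2 * i = d) (p i))"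

lemma lookup_free_poly_projection:
  "Poly_Mapping.lookup (free_poly_projection d p i) w =
    (if length (letters w) + 2 * i = d then Poly_Mapping.lookup (p i) w else 0)"
  by (simp add: free_poly_projection_def lookup_restrict_words)

lemma free_poly_projection_closed [simp]:
  "p \<in> carrier (UP (free_algebra S)) \<Longrightarrow> free_poly_projection d p \<in> carrier (UP (free_algebra S))"
  unfolding UP_carrier_iff free_poly_projection_def by (metis restrict_words_closed restrict_words_zero)

lemma free_poly_decomposition:
  assumes p: "p \<in> carrier (UP (free_algebra S))"
  shows "\<exists>N. (\<forall>d>N. free_poly_projection d p = \<zero>\<^bsub>UP (free_algebra S)\<^esub>) \<and>
    p = (\<Oplus>\<^bsub>UP (free_algebra S)\<^esub>d\<in>{..N}. free_poly_projection d p)"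
proof -
  obtain M where M: "\<forall>i>M. p i = 0" using p by (auto simp: UP_carrier_iff)
  have "finite (\<Union>i\<le>M. (\<lambda>w. length (letters w) + 2 * i) ` Poly_Mapping.keys (p i))" by simp
  then obtain N where N: "\<forall>d \<in> (\<Union>i\<le>M. (\<lambda>w. length (letters w) + 2 * i) ` Poly_Mapping.keys (p i)). d \<le> N"
    using finite_nat_set_iff_bounded_le by blast
  have bound: "length (letters w) + 2 * i \<le> N" if "Poly_Mapping.lookup (p i) w \<noteq> 0" for i w
  proof -
    have "i \<le> M" using M that by (cases "i \<le> M") auto
    then show ?thesis using N that by (auto simp: in_keys_iff)
  qed
  have "free_poly_projection d p = \<zero>\<^bsub>UP (free_algebra S)\<^esub>" if "d > N" for d
  proof
    fix i
    show "free_poly_projection d p i = \<zero>\<^bsub>UP (free_algebra S)\<^esub> i"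
      using bound[of i] that
      by (intro poly_mapping_eqI) (auto simp: UP_zero lookup_free_poly_projection not_less[symmetric])
  qed
  moreover have "p i = (\<Sum>d\<le>N. free_poly_projection d p i)" for i
  proof (rule poly_mapping_eqI)
    fix w
    have "(\<Sum>d\<le>N. Poly_Mapping.lookup (free_poly_projection d p i) w) =
      (\<Sum>d\<le>N. if d = length (letters w) + 2 * i then Poly_Mapping.lookup (p i) w else 0)"
      by (intro sum.cong) (auto simp: lookup_free_poly_projection)
    then show "Poly_Mapping.lookup (p i) w =
        Poly_Mapping.lookup (\<Sum>d\<le>N. free_poly_projection d p i) w"
      using bound[of i w] by (auto simp: lookup_sum)
  qed
  then have "p = (\<Oplus>\<^bsub>UP (free_algebra S)\<^esub>d\<in>{..N}. free_poly_projection d p)"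
    using p by (subst UP_finsum) auto
  ultimately show ?thesis by blast
qed

lemma lookup_free_poly_component:
  "p \<in> free_poly_component S d \<Longrightarrow> length (letters w) + 2 * i \<noteq> d \<Longrightarrow> Poly_Mapping.lookup (p i) w = 0"
  by (rule ccontr) (auto simp: free_poly_component_def simp flip: in_keys_iff)

lemma free_poly_component_mult:
  assumes p: "p \<in> free_poly_component S d" and q: "q \<in> free_poly_component S e"
  shows "p \<otimes>\<^bsub>UP (free_algebra S)\<^esub> q \<in> free_poly_component S (d + e)"
proof -
  interpret P: ring "UP (free_algebra S)" by (rule ring_UP_free_algebra)
  have pq: "p \<in> carrier (UP (free_algebra S))" "q \<in> carrier (UP (free_algebra S))"
    using p q by (auto simp: free_poly_component_def)
  have "length (letters w) + 2 * k = d + e"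
    if w: "w \<in> Poly_Mapping.keys ((p \<otimes>\<^bsub>UP (free_algebra S)\<^esub> q) k)" for k w
  proof -
    have "(\<Sum>i\<le>k. Poly_Mapping.lookup (p i * q (k - i)) w) \<noteq> 0"
      using w pq by (simp add: UP_mult in_keys_iff lookup_sum)
    then obtain i where i: "i \<le> k" "w \<in> Poly_Mapping.keys (p i * q (k - i))"
      by (rule sum.not_neutral_contains_not_neutral) (simp add: in_keys_iff)
    then obtain u v where uv: "w = u + v" "u \<in> Poly_Mapping.keys (p i)"
        "v \<in> Poly_Mapping.keys (q (k - i))"
      using keys_mult[of "p i" "q (k - i)"] by blast
    then have "length (letters u) + 2 * i = d" "length (letters v) + 2 * (k - i) = e"
      using p q by (auto simp: free_poly_component_def)
    then show ?thesis using uv i(1) by simp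
  qed
  then show ?thesis using pq by (simp add: free_poly_component_def)
qed

text \<open>
  A polynomial is the finite sum of its projections because the words in its coefficients have
  bounded length.
\<close>

lemma free_poly_graded:
  "graded_ring (UP (free_algebra S :: ('a, 'k::field) free_alg ring)) (free_poly_component S) free_poly_projection"
proof -
  let ?P = "UP (free_algebra S :: ('a, 'k) free_alg ring)"
  interpret P: ring ?P by (rule ring_UP_free_algebra)
  show ?thesis
  proof (intro graded_ring.intro graded_ring_axioms.intro P.ring_axioms)
    fix d
    show "additive_subgroup (free_poly_component S d) ?P"
    proof (intro additive_subgroup.intro P.add.subgroupI)
      have "\<zero>\<^bsub>?P\<^esub> \<in> free_poly_component S d"
        using P.zero_closed by (simp add: free_poly_component_def UP_zero)
      then show "free_poly_component S d \<noteq> ({} :: (nat \<Rightarrow> ('a, 'k) free_alg) set)" by blast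
      fix p :: "nat \<Rightarrow> ('a, 'k) free_alg" assume p: "p \<in> free_poly_component S d"
      then have "p \<in> carrier ?P" by (simp add: free_poly_component_def)
      from P.a_inv_closed[OF this] UP_a_inv[OF this] show "\<ominus>\<^bsub>?P\<^esub> p \<in> free_poly_component S d"
        using p by (simp add: free_poly_component_def in_keys_iff)
      fix q :: "nat \<Rightarrow> ('a, 'k) free_alg" assume q: "q \<in> free_poly_component S d"
      have "length (letters w) + 2 * i = d" if "w \<in> Poly_Mapping.keys (p i + q i)" for w i
        using that p q keys_add[of "p i" "q i"] by (auto simp: free_poly_component_def)
      then show "p \<oplus>\<^bsub>?P\<^esub> q \<in> free_poly_component S d"
        using p q P.a_closed[of p q] by (auto simp: free_poly_component_def UP_add)
    qed (auto simp: free_poly_component_def)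
  next
    have "\<one>\<^bsub>?P\<^esub> \<in> carrier ?P" by simp
    then show "\<one>\<^bsub>?P\<^esub> \<in> free_poly_component S 0"
      unfolding free_poly_component_def by (auto simp: UP_one split: if_splits)
  next
    fix p q d assume "p \<in> carrier ?P" "q \<in> carrier ?P"
    then show "free_poly_projection d (p \<oplus>\<^bsub>?P\<^esub> q) =
        free_poly_projection d p \<oplus>\<^bsub>?P\<^esub> free_poly_projection d q"
      by (auto simp: UP_add fun_eq_iff poly_mapping_eq_iff lookup_add lookup_free_poly_projection)
  next
    fix p :: "nat \<Rightarrow> ('a, 'k) free_alg" and d e assume "p \<in> free_poly_component S e" "d \<noteq> (e::nat)"
    then show "free_poly_projection d p = \<zero>\<^bsub>?P\<^esub>"
      by (auto simp: UP_zero fun_eq_iff poly_mapping_eq_iff lookup_free_poly_projection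
          lookup_free_poly_component)
  next
    fix p :: "nat \<Rightarrow> ('a, 'k) free_alg" and d assume "p \<in> free_poly_component S d"
    then show "free_poly_projection d p = p"
      by (auto simp: fun_eq_iff poly_mapping_eq_iff lookup_free_poly_projection
          lookup_free_poly_component)
  next
    fix p d assume "p \<in> carrier ?P"
    then show "free_poly_projection d p \<in> free_poly_component S d"
      using free_poly_projection_closed[of p S d]
      by (simp add: free_poly_component_def free_poly_projection_def keys_restrict_words)
  qed (fact free_poly_component_mult free_poly_decomposition)+
qed

section \<open>The overlap of three relations\<close>

text \<open>
  The relation with a free parameter \<open>y\<close>: it is \<open>1\<close> for the skew Clifford algebra, and for the graded
  algebra it is the quadratic element that replaces the central generator.
\<close>

definition skew_relation ::
  "'k::field \<Rightarrow> 'k \<Rightarrow> ('a, 'k) free_alg \<Rightarrow> ('a, 'k) free_alg \<Rightarrow> ('a, 'k) free_alg \<Rightarrow> ('a, 'k) free_alg" where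
  "skew_relation m \<beta> y a b = a * b + fscal m * (b * a) - fscal (2 * \<beta>) * y"

lemma skew_relation_closed [simp]:
  "a \<in> carrier (free_algebra S) \<Longrightarrow> b \<in> carrier (free_algebra S) \<Longrightarrow> y \<in> carrier (free_algebra S) \<Longrightarrow>
    skew_relation m \<beta> y a b \<in> carrier (free_algebra S)"
  by (auto simp: skew_relation_def)

lemma fscal_left_commute: "p * (fscal c * q) = fscal c * (p * q)"
  by (simp add: fscal_commute[of p] flip: mult.assoc)

text \<open>
  What remains when \<open>a b c\<close> is rewritten to \<open>c b a\<close> by three skew relations, once starting with \<open>a b\<close>
  and once with \<open>b c\<close>. Products with \<open>y\<close> on the left and on the right are kept apart,
  because \<open>y\<close> need not be central.
\<close>

definition overlap ::
  "'k::field \<Rightarrow> 'k \<Rightarrow> 'k \<Rightarrow> 'k \<Rightarrow> 'k \<Rightarrow> 'k \<Rightarrow>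
   ('a, 'k) free_alg \<Rightarrow> ('a, 'k) free_alg \<Rightarrow> ('a, 'k) free_alg \<Rightarrow> ('a, 'k) free_alg \<Rightarrow> ('a, 'k) free_alg"
  where
  "overlap mab mac mbc \<beta>ab \<beta>ac \<beta>bc y a b c =
     fscal (2 * \<beta>ab) * (fscal (mbc * mac) * (c * y) - y * c)
   + fscal (2 * \<beta>ac) * (fscal mab * (b * y) - fscal mbc * (y * b))
   + fscal (2 * \<beta>bc) * (a * y - fscal (mab * mac) * (y * a))"

text \<open>
  The right-hand side records the rewriting steps: the terms of degree three in \<open>a\<close>, \<open>b\<close>, \<open>c\<close> cancel.
\<close>

lemma overlap_eq:
  fixes a b c y :: "('a, 'k::field) free_alg"
  shows "overlap mab mac mbc \<beta>ab \<beta>ac \<beta>bc y a b c =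
    skew_relation mab \<beta>ab y a b * c - a * skew_relation mbc \<beta>bc y b c
    + fscal mbc * (skew_relation mac \<beta>ac y a c * b) - fscal mab * (b * skew_relation mac \<beta>ac y a c)
    + fscal (mab * mac) * (skew_relation mbc \<beta>bc y b c * a)
    - fscal (mbc * mac) * (c * skew_relation mab \<beta>ab y a b)"
proof -
  have comm: "p * (fscal k * q) = fscal k * (p * q)" "p * fscal k = fscal k * p"
    if "p \<in> {a, b, c, y}" for p q and k :: 'k
    by (rule fscal_left_commute fscal_commute)+
  have scal: "fscal k * (fscal l * q) = fscal (k * l) * q" for k l and q :: "('a, 'k) free_alg"
    by (simp add: fscal_simps mult.assoc)
  show ?thesis
    unfolding overlap_def skew_relation_def
    by (simp add: distrib_left distrib_right left_diff_distrib right_diff_distrib mult.assoc comm scal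
        del: mult_cancel_left) (simp add: mult.commute mult.left_commute algebra_simps)
qed

lemma overlap_in_ideal:
  assumes J: "ideal J (free_algebra S)"
    and "a \<in> carrier (free_algebra S)" "b \<in> carrier (free_algebra S)" "c \<in> carrier (free_algebra S)"
    and "skew_relation mab \<beta>ab y a b \<in> J" "skew_relation mac \<beta>ac y a c \<in> J"
      "skew_relation mbc \<beta>bc y b c \<in> J"
  shows "overlap mab mac mbc \<beta>ab \<beta>ac \<beta>bc y a b c \<in> J"
  unfolding overlap_eq using assms(2-)
  by (intro ideal_free_algebraD(3)[OF J] ideal_free_algebraD(5)[OF J])
     (auto intro: ideal_free_algebraD(6,7)[OF J])

section \<open>Independence of the generators of a full-dimensional skew Clifford algebra\<close>

text \<open>
  If \<open>\<alpha>\<close> were nonzero, the generator \<open>x k\<close> would be a combination of the other generators. Then the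
  squarefree products of the other \<open>n - 1\<close> generators span a subspace that is closed under
  multiplication by all generators and contains \<open>1\<close>, hence span the whole algebra, whose dimension
  would be at most \<open>2 ^ (n - 1)\<close>.
\<close>

lemma skew_generators_independent:
  fixes \<pi> :: "('v::ab_group_add, 'k::field) free_alg \<Rightarrow> 'r" and R (structure)
  assumes hom: "ring_hom_ring (free_algebra UNIV) R \<pi>"
    and surj: "carrier R = range \<pi>"
    and vs: "vector_space scale" and basis: "ordered_basis scale n x"
    and two: "(2::'k) \<noteq> 0" and \<mu>: "\<And>i. i \<in> {1..n} \<Longrightarrow> \<mu> i i = 1"
    and add: "\<And>u v. \<pi> (fgen (u + v)) = \<pi> (fgen u + fgen v)"
    and scale: "\<And>c v. \<pi> (fgen (scale c v)) = \<pi> (fscal c * fgen v)"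
    and rel: "\<And>i j. i \<in> {1..n} \<Longrightarrow> j \<in> {1..n} \<Longrightarrow>
      \<pi> (skew_relation (\<mu> i j) (B i j) 1 (fgen (x i)) (fgen (x j))) = \<zero>"
    and dim: "ring.dimension R (2 ^ n) (range (\<lambda>c. \<pi> (fscal c))) (carrier R)"
    and k: "k \<in> {1..n}" and i: "i \<in> {1..n} - {k}" and j: "j \<in> {1..n} - {k}"
    and dep: "\<pi> (fscal \<alpha> * fgen (x k) + fscal \<beta> * fgen (x j) + fscal \<gamma> * fgen (x i)) = \<zero>"
  shows "\<alpha> = 0"
proof (rule ccontr)
  assume \<alpha>: "\<alpha> \<noteq> 0"
  interpret R: ring R using hom by (simp add: ring_hom_ring_def)
  interpret \<pi>: ring_hom_ring "free_algebra UNIV" R \<pi> by (rule hom)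
  interpret V: vector_space scale by (rule vs)
  have \<pi>_closed [simp]: "\<pi> p \<in> carrier R" for p by (rule \<pi>.hom_closed) simp
  have \<pi>_add: "\<pi> (p + q) = \<pi> p \<oplus> \<pi> q" for p q using \<pi>.hom_add[of p q] by simp
  have \<pi>_mult: "\<pi> (p * q) = \<pi> p \<otimes> \<pi> q" for p q using \<pi>.hom_mult[of p q] by simp
  have \<pi>_eqI: "\<pi> p = \<pi> q" if "\<pi> (p - q) = \<zero>" for p q
    using \<pi>_add[of "p - q" q] that by simp
  define K where "K = range (\<lambda>c. \<pi> (fscal c))"
  have K_hom: "ring_hom_ring (ring_of_type_algebra :: 'k ring) R (\<lambda>c. \<pi> (fscal c))"
    using \<pi>.hom_one
    by (intro ring_hom_ringI2 ring_from_type_algebra R.ring_axioms ring_hom_memI)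
       (simp_all add: ring_of_type_algebra_def fscal_simps \<pi>_add \<pi>_mult)
  \<comment> \<open>In the zero ring only \<open>0\<close> can be a dimension, and the scalars would not form a field.\<close>
  have "\<one> \<noteq> \<zero>"
  proof
    assume "\<one> = \<zero>"
    then have zero: "carrier R = {\<zero>}" by (rule R.one_zeroD)
    have "R.dimension m L E \<Longrightarrow> m = 0 \<and> E = {\<zero>}" for m L E
      by (induction rule: R.dimension.induct) (use zero in auto)
    from this[OF dim] show False by simp
  qed
  then have K: "subfield K R"
    using ring_hom_ring.img_is_subfield(2)[OF K_hom
        field.carrier_is_subfield[OF field_from_type_algebra]]
    by (simp add: K_def ring_of_type_algebra_def)
  have central: "m \<otimes> a = a \<otimes> m" if "m \<in> K" "a \<in> carrier R" for m a
    using that surj by (auto simp: K_def fscal_commute simp flip: \<pi>_mult)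
  define gx where "gx l = \<pi> (fgen (x l))" for l
  define zs where "zs = map gx (filter (\<lambda>l. l \<noteq> k) [1..<Suc n])"
  have set_zs: "set zs = gx ` ({1..n} - {k})" by (auto simp: zs_def)
  have zs: "set zs \<subseteq> carrier R" by (auto simp: set_zs gx_def)
  let ?M = "R.squarefree_products zs"
  define E where "E = R.Span K ?M"
  have M: "set ?M \<subseteq> carrier R" by (rule R.squarefree_products_carrier[OF zs])
  have zs_rel: "\<exists>k\<in>K. \<exists>l\<in>K. u \<otimes> v = k \<otimes> (v \<otimes> u) \<oplus> l" if uv: "u \<in> set zs" "v \<in> set zs" for u v
  proof -
    from uv obtain a b where ab: "a \<in> {1..n}" "b \<in> {1..n}" "u = gx a" "v = gx b"
      unfolding set_zs by blast
    have "\<pi> (fgen (x a) * fgen (x b)) =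
      \<pi> (fscal (- \<mu> a b) * (fgen (x b) * fgen (x a)) + fscal (2 * B a b))"
      using rel[OF ab(1,2)] by (intro \<pi>_eqI) (simp add: skew_relation_def fscal_simps algebra_simps)
    then have "u \<otimes> v = \<pi> (fscal (- \<mu> a b)) \<otimes> (v \<otimes> u) \<oplus> \<pi> (fscal (2 * B a b))"
      by (simp add: ab gx_def \<pi>_add \<pi>_mult)
    then show ?thesis unfolding K_def by blast
  qed
  \<comment> \<open>As \<open>\<mu> a a = 1\<close>, the relation for \<open>a\<close>, \<open>a\<close> is twice the difference of the square and a scalar.\<close>
  have zs_sq: "u \<otimes> u \<in> K" if u: "u \<in> set zs" for u
  proof -
    from u obtain a where a: "a \<in> {1..n}" "u = gx a" unfolding set_zs by blast
    let ?r = "skew_relation (\<mu> a a) (B a a) 1 (fgen (x a)) (fgen (x a))"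
    have "?r = fscal 2 * (fgen (x a) * fgen (x a) - fscal (B a a))"
    proof -
      have "fscal (2::'k) = (2 :: ('v, 'k) free_alg)"
        using fscal_simps(3)[of "1::'k" 1] by (simp only: fscal_simps(2) one_add_one)
      then show ?thesis
        by (simp only: skew_relation_def \<mu>[OF a(1)] fscal_simps(2,3,4) mult_1_left mult_1_right
            right_diff_distrib mult_2)
    qed
    then have "fgen (x a) * fgen (x a) - fscal (B a a) = fscal (inverse 2) * ?r"
      using two by (simp add: fscal_simps(2) flip: mult.assoc fscal_simps(4))
    then have "\<pi> (fgen (x a) * fgen (x a)) = \<pi> (fscal (B a a))"
      using rel[OF a(1) a(1)] by (intro \<pi>_eqI) (simp add: \<pi>_mult)
    then show ?thesis by (auto simp: a gx_def \<pi>_mult K_def)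
  qed
  have Xk: "gx k \<in> R.Span K zs"
  proof -
    have "fgen (x k) - (fscal (- \<beta> / \<alpha>) * fgen (x j) + fscal (- \<gamma> / \<alpha>) * fgen (x i))
      = fscal (inverse \<alpha>) * (fscal \<alpha> * fgen (x k) + fscal \<beta> * fgen (x j) + fscal \<gamma> * fgen (x i))"
      using \<alpha> by (simp add: distrib_left fscal_simps(2,5) field_simps flip: mult.assoc fscal_simps(4))
    then have "\<pi> (fgen (x k)) = \<pi> (fscal (- \<beta> / \<alpha>) * fgen (x j) + fscal (- \<gamma> / \<alpha>) * fgen (x i))"
      using dep by (intro \<pi>_eqI) (simp add: \<pi>_mult)
    then have "gx k = \<pi> (fscal (- \<beta> / \<alpha>)) \<otimes> gx j \<oplus> \<pi> (fscal (- \<gamma> / \<alpha>)) \<otimes> gx i"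
      by (simp add: gx_def \<pi>_add \<pi>_mult)
    moreover have term_in: "\<pi> (fscal c) \<otimes> gx l \<in> R.Span K zs" if "l \<in> {1..n} - {k}" for c l
    proof (rule R.Span_smult_closed[OF K zs])
      show "\<pi> (fscal c) \<in> K" by (simp add: K_def)
      show "gx l \<in> R.Span K zs" using R.Span_base_incl[OF K zs] that set_zs by blast
    qed
    ultimately show ?thesis
      using R.Span_subgroup_props(3)[OF K zs term_in[OF j] term_in[OF i]] by metis
  qed
  have mult_gx: "gx l \<otimes> w \<in> E" if "l \<in> {1..n}" "w \<in> E" for l w
    unfolding E_def
  proof (rule R.Span_mult_squarefree_products[OF K])
    show "gx l \<in> R.Span K zs"
      using Xk R.Span_base_incl[OF K zs] that(1) by (cases "l = k") (auto simp: set_zs simp del: R.Span.simps)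
    show "w \<in> R.Span K ?M" using that(2) by (simp add: E_def)
    show "set zs \<subseteq> carrier R" by (rule zs)
  qed (fact central zs_rel zs_sq)+
  note E_add = R.Span_subgroup_props(3)[OF K M, folded E_def]
  note E_scal = R.Span_smult_closed[OF K M, folded E_def]
  have E_carrier: "E \<subseteq> carrier R" unfolding E_def by (rule R.Span_subgroup_props(1)[OF K M])
  have mult_V: "\<forall>w\<in>E. \<pi> (fgen v) \<otimes> w \<in> E" for v
  proof -
    have "v \<in> V.span (x ` {1..n})" using basis by (simp add: ordered_basis_def)
    then show ?thesis
    proof (induction rule: V.span_induct_alt)
      case base
      have "\<pi> (fgen 0) = \<pi> (fscal 0 * fgen 0)" using scale[of 0 0] by simp
      also have "\<dots> = \<zero>" using \<pi>.hom_zero by (simp add: fscal_simps)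
      finally show ?case using E_carrier R.Span_subgroup_props(2)[OF K M, folded E_def] by auto
    next
      case (step c b v)
      then obtain l where l: "l \<in> {1..n}" "b = x l" by blast
      show ?case
      proof
        fix w assume w: "w \<in> E"
        then have w': "w \<in> carrier R" using E_carrier by blast
        have "\<pi> (fgen (scale c b + v)) \<otimes> w = \<pi> (fscal c) \<otimes> (gx l \<otimes> w) \<oplus> \<pi> (fgen v) \<otimes> w"
          using w' by (simp add: add \<pi>_add scale \<pi>_mult l gx_def R.l_distr R.m_assoc)
        also have "\<dots> \<in> E"
        proof (rule E_add)
          show "\<pi> (fscal c) \<otimes> (gx l \<otimes> w) \<in> E"
            by (rule E_scal[OF _ mult_gx[OF l(1) w]]) (simp add: K_def)
          show "\<pi> (fgen v) \<otimes> w \<in> E" using step w by blast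
        qed
        finally show "\<pi> (fgen (scale c b + v)) \<otimes> w \<in> E" .
      qed
    qed
  qed
  have "\<pi> p \<in> E" for p
  proof -
    have "p \<in> carrier (free_algebra UNIV)" by simp
    then show ?thesis
    proof (induction rule: free_algebra_induct)
      case (scal c)
      have "\<one> \<in> E"
        unfolding E_def using R.Span_base_incl[OF K M] R.one_in_squarefree_products[of zs] by blast
      from E_scal[OF _ this, of "\<pi> (fscal c)"] show ?case by (simp add: K_def)
    next
      case (gen a p)
      then show ?case using mult_V by (simp add: \<pi>_mult)
    next
      case (add p q)
      then show ?case using E_add by (simp add: \<pi>_add)
    qed
  qed
  then have "E = carrier R" using E_carrier surj by auto
  then have "2 ^ n \<le> length ?M"
    using dim R.dimension_le_length[OF K M] by (simp add: E_def K_def)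
  moreover have "length zs < n"
  proof -
    have "length (filter (\<lambda>l. l \<noteq> k) [1..<Suc n]) < length [1..<Suc n]"
      using k by (intro length_filter_less[of k]) auto
    then show ?thesis by (simp only: zs_def length_map length_upt diff_Suc_1)
  qed
  ultimately show False
    by (simp add: R.length_squarefree_products)
qed

text \<open>
  The first three conditions are the vanishing, for \<open>y = 1\<close>, of the coefficients of \<open>x k\<close>, \<open>x j\<close> and
  \<open>x i\<close> in the overlap of \<open>x i\<close>, \<open>x j\<close>, \<open>x k\<close>, each under the condition that this generator differs
  from the two others. The last one comes from the overlap of \<open>x i\<close>, \<open>x i\<close>, \<open>x k\<close>.
\<close>

definition overlap_consistent :: "nat \<Rightarrow> (nat \<Rightarrow> nat \<Rightarrow> 'k::field) \<Rightarrow> (nat \<Rightarrow> nat \<Rightarrow> 'k) \<Rightarrow> bool" where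
  "overlap_consistent n \<mu> B \<longleftrightarrow> (\<forall>i\<in>{1..n}. \<forall>j\<in>{1..n}. \<forall>k\<in>{1..n}.
     (k \<noteq> i \<and> k \<noteq> j \<longrightarrow> \<mu> j k * \<mu> i k * B i j = B i j) \<and>
     (j \<noteq> i \<and> j \<noteq> k \<longrightarrow> \<mu> i j * B i k = \<mu> j k * B i k) \<and>
     (i \<noteq> j \<and> i \<noteq> k \<longrightarrow> \<mu> i j * \<mu> i k * B j k = B j k) \<and>
     (i \<noteq> k \<longrightarrow> \<mu> i k * B i k = B i k))"

lemma ring_hom_kernel_ideal:
  assumes "ring_hom_ring (free_algebra UNIV) R \<pi>"
  shows "ideal {p. \<pi> p = \<zero>\<^bsub>R\<^esub>} (free_algebra UNIV)"
proof -
  interpret ring_hom_ring "free_algebra UNIV" R \<pi> by (rule assms)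
  have "a_kernel (free_algebra UNIV) R \<pi> = {p. \<pi> p = \<zero>\<^bsub>R\<^esub>}"
    unfolding a_kernel_def' by simp
  then show ?thesis using kernel_is_ideal by metis
qed

text \<open>
  The skew Clifford algebra is a quotient of a quotient; composing the two projections gives a
  homomorphism from the free algebra on all vectors. Its kernel contains the skew relations with
  \<open>y = 1\<close>, hence their overlaps, and these are linear in the generators.
\<close>

lemma full_dimension_overlap_consistent:
  fixes scale :: "'k::field \<Rightarrow> 'v::ab_group_add \<Rightarrow> 'v"
  assumes two: "(2::'k) \<noteq> 0"
    and vs: "vector_space scale"
    and basis: "ordered_basis scale n x"
    and \<mu>: "mult_antisymmetric n \<mu>"
    and full: "full_dimension scale n x \<mu> \<phi>"
  shows "overlap_consistent n \<mu> (\<lambda>i j. \<phi> (x i) (x j))"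
proof -
  let ?F = "free_algebra UNIV :: ('v, 'k) free_alg ring"
  let ?T = "tensor_algebra scale" and ?R = "sCl scale n x \<mu> \<phi>"
  let ?I = "tensor_ideal scale" and ?L = "sCl_ideal scale n x \<mu> \<phi>"
  interpret F: ring ?F by (rule ring_free_algebra)
  interpret V: vector_space scale by (rule vs)
  have I: "ideal ?I ?F"
    unfolding tensor_ideal_def by (rule F.genideal_ideal) (simp add: subset_iff)
  interpret I: ideal ?I ?F by (rule I)
  interpret T: ring ?T unfolding tensor_algebra_def by (rule I.quotient_is_ring)
  interpret \<tau>: ring_hom_ring ?F ?T "(+>\<^bsub>?F\<^esub>) ?I"
    unfolding tensor_algebra_def by (rule I.rcos_ring_hom_ring)
  have \<tau>: "?I +>\<^bsub>?F\<^esub> p \<in> carrier ?T" for p by (rule \<tau>.hom_closed) simp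
  define r where "r i j = skew_relation (\<mu> i j) (\<phi> (x i) (x j)) 1 (fgen (x i)) (fgen (x j))" for i j
  have gen: "(tensor_vec scale (x i) \<otimes>\<^bsub>?T\<^esub> tensor_vec scale (x j)) \<oplus>\<^bsub>?T\<^esub>
      (tensor_scal scale (\<mu> i j) \<otimes>\<^bsub>?T\<^esub> (tensor_vec scale (x j) \<otimes>\<^bsub>?T\<^esub> tensor_vec scale (x i)))
      \<ominus>\<^bsub>?T\<^esub> tensor_scal scale (2 * \<phi> (x i) (x j)) = ?I +>\<^bsub>?F\<^esub> r i j" for i j
    using \<tau>.hom_add[of "fgen (x i) * fgen (x j) + fscal (\<mu> i j) * (fgen (x j) * fgen (x i))"
        "- fscal (2 * \<phi> (x i) (x j))"]
      \<tau>.hom_add[of "fgen (x i) * fgen (x j)" "fscal (\<mu> i j) * (fgen (x j) * fgen (x i))"]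
      \<tau>.hom_mult[of "fgen (x i)" "fgen (x j)"] \<tau>.hom_mult[of "fgen (x j)" "fgen (x i)"]
      \<tau>.hom_mult[of "fscal (\<mu> i j)" "fgen (x j) * fgen (x i)"]
      \<tau>.hom_a_inv[of "fscal (2 * \<phi> (x i) (x j))"]
    by (simp add: tensor_vec_def tensor_scal_def r_def skew_relation_def a_minus_def)
  have L_eq: "?L = Idl\<^bsub>?T\<^esub> {?I +>\<^bsub>?F\<^esub> r i j | i j. i \<in> {1..n} \<and> j \<in> {1..n}}"
    by (simp only: sCl_ideal_def Let_def gen)
  have gens: "{?I +>\<^bsub>?F\<^esub> r i j | i j. i \<in> {1..n} \<and> j \<in> {1..n}} \<subseteq> carrier ?T"
    using \<tau> by blast
  have L: "ideal ?L ?T" unfolding L_eq by (rule T.genideal_ideal[OF gens])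
  interpret L: ideal ?L ?T by (rule L)
  interpret R: ring ?R unfolding sCl_def by (rule L.quotient_is_ring)
  define \<pi> where "\<pi> p = ?L +>\<^bsub>?T\<^esub> (?I +>\<^bsub>?F\<^esub> p)" for p
  have \<pi>_ring_hom: "\<pi> \<in> ring_hom ?F ?R"
    using ring_hom_trans[OF \<tau>.homh L.rcos_ring_hom]
    by (simp add: \<pi>_def[abs_def] comp_def sCl_def)
  then have hom: "ring_hom_ring ?F ?R \<pi>"
    by (intro ring_hom_ringI2 F.ring_axioms R.ring_axioms)
  have surj: "carrier ?R = range \<pi>"
    unfolding sCl_def L.quotient_carrier unfolding tensor_algebra_def I.quotient_carrier
    by (auto simp: \<pi>_def tensor_algebra_def)
  have ker_\<tau>: "\<pi> p = \<pi> q" if "p - q \<in> ?I" for p q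
  proof -
    have "?I +>\<^bsub>?F\<^esub> p = ?I +>\<^bsub>?F\<^esub> q"
      using F.quotient_eq_iff_same_a_r_cos[OF I, of p q] that by simp
    then show ?thesis by (simp add: \<pi>_def)
  qed
  have gens_I: "{fgen (u + v) - fgen u - fgen v | u v. True} \<union>
      {fgen (scale c v) - fscal c * fgen v | c v. True} \<subseteq> ?I"
    unfolding tensor_ideal_def by (rule F.genideal_self) auto
  have \<pi>_plus: "\<pi> (fgen (u + v)) = \<pi> (fgen u + fgen v)" for u v
    by (rule ker_\<tau>) (use gens_I in \<open>auto simp: diff_diff_eq[symmetric]\<close>)
  have \<pi>_scale: "\<pi> (fgen (scale c v)) = \<pi> (fscal c * fgen v)" for c v
    by (rule ker_\<tau>) (use gens_I in auto)
  have rel: "\<pi> (r i j) = \<zero>\<^bsub>?R\<^esub>" if "i \<in> {1..n}" "j \<in> {1..n}" for i j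
  proof -
    have "?I +>\<^bsub>?F\<^esub> r i j \<in> ?L"
      unfolding L_eq using T.genideal_self[OF gens] that by blast
    then show ?thesis using L.coset_eq_zero_iff[OF \<tau>] by (simp add: \<pi>_def sCl_def)
  qed
  have "V.dim (UNIV :: 'v set) = n"
    using V.dim_eq_card[of "x ` {1..n}" UNIV] basis by (simp add: ordered_basis_def card_image)
  then have dim: "ring.dimension ?R (2 ^ n) (range (\<lambda>c. \<pi> (fscal c))) (carrier ?R)"
    using full by (simp add: full_dimension_def sCl_scal_def[abs_def] tensor_scal_def \<pi>_def[abs_def])
  define J where "J = {p. \<pi> p = \<zero>\<^bsub>?R\<^esub>}"
  have J: "ideal J ?F" unfolding J_def by (rule ring_hom_kernel_ideal[OF hom])
  have indep: "\<alpha> = 0"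
    if "k \<in> {1..n}" "i \<in> {1..n} - {k}" "j \<in> {1..n} - {k}"
      "fscal \<alpha> * fgen (x k) + fscal \<beta> * fgen (x j) + fscal \<gamma> * fgen (x i) \<in> J" for i j k \<alpha> \<beta> \<gamma>
    using that \<mu>
    by (intro skew_generators_independent[OF hom surj vs basis two _ \<pi>_plus \<pi>_scale
          rel[unfolded r_def] dim, of k i j \<alpha> \<beta> \<gamma>])
       (auto simp: J_def mult_antisymmetric_def)
  have linear: "fscal (2 * \<phi> (x i) (x j) * (\<mu> j k * \<mu> i k - 1)) * fgen (x k)
      + fscal (2 * \<phi> (x i) (x k) * (\<mu> i j - \<mu> j k)) * fgen (x j)
      + fscal (2 * \<phi> (x j) (x k) * (1 - \<mu> i j * \<mu> i k)) * fgen (x i) \<in> J"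
    if "i \<in> {1..n}" "j \<in> {1..n}" "k \<in> {1..n}" for i j k
  proof -
    have "overlap (\<mu> i j) (\<mu> i k) (\<mu> j k) (\<phi> (x i) (x j)) (\<phi> (x i) (x k)) (\<phi> (x j) (x k))
        1 (fgen (x i)) (fgen (x j)) (fgen (x k)) \<in> J"
      using rel[unfolded r_def] that by (intro overlap_in_ideal[OF J]) (auto simp: J_def)
    then show ?thesis
      by (simp add: overlap_def fscal_simps(2,4,6) left_diff_distrib right_diff_distrib mult.assoc)
  qed
  show ?thesis
    unfolding overlap_consistent_def
  proof (intro ballI conjI impI)
    fix i j k assume ijk: "i \<in> {1..n}" "j \<in> {1..n}" "k \<in> {1..n}"
    let ?a = "fscal (2 * \<phi> (x i) (x j) * (\<mu> j k * \<mu> i k - 1)) * fgen (x k)"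
    let ?b = "fscal (2 * \<phi> (x i) (x k) * (\<mu> i j - \<mu> j k)) * fgen (x j)"
    let ?c = "fscal (2 * \<phi> (x j) (x k) * (1 - \<mu> i j * \<mu> i k)) * fgen (x i)"
    have lin: "?a + ?b + ?c \<in> J" by (rule linear[OF ijk])
    then have lin': "?b + ?a + ?c \<in> J" "?c + ?a + ?b \<in> J" by (simp_all only: add_ac)
    show "\<mu> j k * \<mu> i k * \<phi> (x i) (x j) = \<phi> (x i) (x j)" if "k \<noteq> i \<and> k \<noteq> j"
    proof -
      have "2 * \<phi> (x i) (x j) * (\<mu> j k * \<mu> i k - 1) = 0"
        by (rule indep[OF _ _ _ lin]) (use ijk that in auto)
      then show ?thesis using two by (auto simp: algebra_simps)
    qed
    show "\<mu> i j * \<phi> (x i) (x k) = \<mu> j k * \<phi> (x i) (x k)" if "j \<noteq> i \<and> j \<noteq> k"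
    proof -
      have "2 * \<phi> (x i) (x k) * (\<mu> i j - \<mu> j k) = 0"
        by (rule indep[OF _ _ _ lin'(1)]) (use ijk that in auto)
      then show ?thesis using two by (auto simp: algebra_simps)
    qed
    show "\<mu> i j * \<mu> i k * \<phi> (x j) (x k) = \<phi> (x j) (x k)" if "i \<noteq> j \<and> i \<noteq> k"
    proof -
      have "2 * \<phi> (x j) (x k) * (1 - \<mu> i j * \<mu> i k) = 0"
        by (rule indep[OF _ _ _ lin'(2)]) (use ijk that in auto)
      then show ?thesis using two by (auto simp: algebra_simps)
    qed
    show "\<mu> i k * \<phi> (x i) (x k) = \<phi> (x i) (x k)" if "i \<noteq> k"
    proof -
      let ?\<delta> = "2 * \<phi> (x i) (x k) * (1 - \<mu> i k)"
      have ii: "\<mu> i i = 1" using \<mu> ijk by (auto simp: mult_antisymmetric_def)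
      have "fscal (?\<delta> + ?\<delta>) * fgen (x i)
        + fscal (2 * \<phi> (x i) (x i) * (\<mu> i k * \<mu> i k - 1)) * fgen (x k) + fscal 0 * fgen (x k) \<in> J"
        unfolding fscal_simps(3)[of ?\<delta> ?\<delta>]
        using linear[of i i k] ijk by (simp add: ii fscal_simps(1) distrib_right add_ac)
      then have "?\<delta> + ?\<delta> = 0"
        by (rule indep[rotated 3]) (use ijk that in auto)
      then have "2 * ?\<delta> = 0" by (simp only: mult_2)
      then have "?\<delta> = 0" using two mult_eq_0_iff[of 2 ?\<delta>] by blast
      then show ?thesis using two by (auto simp: algebra_simps)
    qed
  qed
qed

section \<open>Centrality of the eliminated generator\<close>

lemma ideal_fscal_cancel:
  fixes c :: "'k::field"
  assumes J: "ideal J (free_algebra S)" and c: "c \<noteq> 0" and p: "fscal c * p \<in> J"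
  shows "p \<in> J"
proof -
  have "fscal (inverse c) * (fscal c * p) \<in> J"
    by (rule ideal_free_algebraD(6)[OF J p]) simp
  then have "fscal (inverse c * c) * p \<in> J" by (simp only: fscal_simps(4) mult.assoc)
  then show ?thesis using c by (simp add: fscal_simps(2))
qed

text \<open>
  Given the consistency conditions, the overlap of three generators becomes a relation between
  their commutators with \<open>y\<close>. If some \<open>B a a\<close> is nonzero, \<open>y\<close> is modulo \<open>J\<close> a multiple of the square
  of \<open>g a\<close>, so \<open>g a\<close> commutes with it, and the overlap of \<open>g a\<close>, \<open>g a\<close>, \<open>g k\<close> yields the commutator of \<open>g k\<close>.
  Otherwise some \<open>B a b\<close> with \<open>a \<noteq> b\<close> is nonzero; the overlaps of \<open>g a\<close>, \<open>g a\<close>, \<open>g b\<close> and of \<open>g b\<close>,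
  \<open>g b\<close>, \<open>g a\<close> give the commutators of \<open>g a\<close> and \<open>g b\<close>, and the overlap of \<open>g a\<close>, \<open>g b\<close>, \<open>g k\<close> gives
  the remaining ones.
\<close>

lemma skew_relations_imply_central:
  fixes \<mu> B :: "nat \<Rightarrow> nat \<Rightarrow> 'k::field" and g :: "nat \<Rightarrow> ('a, 'k) free_alg"
  assumes two: "(2::'k) \<noteq> 0"
    and J: "ideal J (free_algebra S)"
    and g: "\<And>i. i \<in> {1..n} \<Longrightarrow> g i \<in> carrier (free_algebra S)"
    and rel: "\<And>i j. i \<in> {1..n} \<Longrightarrow> j \<in> {1..n} \<Longrightarrow> skew_relation (\<mu> i j) (B i j) y (g i) (g j) \<in> J"
    and \<mu>: "\<And>i. i \<in> {1..n} \<Longrightarrow> \<mu> i i = 1"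
    and symm: "\<And>i j. i \<in> {1..n} \<Longrightarrow> j \<in> {1..n} \<Longrightarrow> B i j = \<mu> i j * B j i"
    and cons: "overlap_consistent n \<mu> B"
    and nonzero: "\<exists>i\<in>{1..n}. \<exists>j\<in>{1..n}. B i j \<noteq> 0"
    and k: "k \<in> {1..n}"
  shows "g k * y - y * g k \<in> J"
proof -
  note J_add = ideal_free_algebraD(3)[OF J] and J_diff = ideal_free_algebraD(5)[OF J]
  note J_left = ideal_free_algebraD(6)[OF J] and J_right = ideal_free_algebraD(7)[OF J]
  define com where "com l = g l * y - y * g l" for l
  have ov: "overlap (\<mu> i j) (\<mu> i l) (\<mu> j l) (B i j) (B i l) (B j l) y (g i) (g j) (g l) \<in> J"
    if "i \<in> {1..n}" "j \<in> {1..n}" "l \<in> {1..n}" for i j l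
    using that by (intro overlap_in_ideal[OF J] g rel)
  have collect: "fscal (2 * \<beta>) * (fscal s * p - fscal t * q) = fscal (2 * (s * \<beta>)) * (p - q)"
    if "s * \<beta> = t * \<beta>" for s t \<beta> and p q :: "('a, 'k) free_alg"
  proof -
    have "2 * \<beta> * s = 2 * (s * \<beta>)" "2 * \<beta> * t = 2 * (t * \<beta>)" by (simp_all add: mult_ac)
    then show ?thesis using that
      by (simp only: right_diff_distrib fscal_simps(4)[symmetric] mult.assoc[symmetric])
  qed
  have collect1: "fscal (2 * \<beta>) * (fscal s * p - q) = fscal (2 * \<beta>) * (p - q)"
      "fscal (2 * \<beta>) * (p - fscal s * q) = fscal (2 * \<beta>) * (p - q)"
    if "s * \<beta> = \<beta>" for s \<beta> and p q :: "('a, 'k) free_alg"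
    using collect[of s \<beta> 1 p q] collect[of 1 \<beta> s p q] that
    by (simp_all only: fscal_simps(2) mult_1_left)
  \<comment> \<open>The commutator of the relation for \<open>i\<close>, \<open>i\<close> with \<open>g i\<close>. The overlap would give this only with a
    factor \<open>6\<close>, which is zero in characteristic three.\<close>
  have square: "com i \<in> J" if i: "i \<in> {1..n}" and "B i i \<noteq> 0" for i
  proof -
    let ?r = "skew_relation (\<mu> i i) (B i i) y (g i) (g i)"
    have "fscal (2 * B i i) * com i = ?r * g i - g i * ?r"
      unfolding skew_relation_def com_def \<mu>[OF i] fscal_simps(2)
      by (simp add: distrib_left distrib_right left_diff_distrib right_diff_distrib mult.assoc
          fscal_left_commute)
    moreover have "?r * g i - g i * ?r \<in> J"
      by (rule J_diff[OF J_right[OF rel g] J_left[OF rel g]]) (rule i)+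
    ultimately have "fscal (2 * B i i) * com i \<in> J" by simp
    then show ?thesis by (rule ideal_fscal_cancel[OF J, rotated]) (use that two in simp)
  qed
  have pair: "fscal (2 * B i i) * com l + fscal (2 * (2 * B i l)) * com i \<in> J"
    if il: "i \<in> {1..n}" "l \<in> {1..n}" "l \<noteq> i" for i l
  proof -
    have "\<mu> i l * \<mu> i l * B i i = B i i" "\<mu> i l * B i l = B i l"
      using cons il unfolding overlap_consistent_def by auto
    moreover have "fscal (2 * (2 * B i l)) = fscal (2 * B i l) + (fscal (2 * B i l) :: ('a, 'k) free_alg)"
      by (simp only: mult_2 fscal_simps(3))
    ultimately show ?thesis
      using ov[of i i l] il
      by (simp only: overlap_def collect1 \<mu> fscal_simps(2) mult_1_left com_def distrib_right add.assoc)
  qed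
  show ?thesis
  proof (cases "\<exists>a\<in>{1..n}. B a a \<noteq> 0")
    case True
    then obtain a where a: "a \<in> {1..n}" "B a a \<noteq> 0" by blast
    have com_a: "com a \<in> J" by (rule square[OF a])
    show ?thesis
    proof (cases "k = a")
      case False
      have "fscal (2 * (2 * B a k)) * com a \<in> J" by (intro J_left com_a) simp
      from J_diff[OF pair[OF a(1) k False] this]
      have "fscal (2 * B a a) * com k \<in> J" by simp
      then have "com k \<in> J" by (rule ideal_fscal_cancel[OF J, rotated]) (use a(2) two in simp)
      then show ?thesis by (simp add: com_def)
    qed (use com_a in \<open>simp add: com_def\<close>)
  next
    case False
    from nonzero obtain a b where ab: "a \<in> {1..n}" "b \<in> {1..n}" "B a b \<noteq> 0" by blast
    with False have "a \<noteq> b" by auto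
    have off_diagonal: "com i \<in> J" if "i \<in> {1..n}" "l \<in> {1..n}" "l \<noteq> i" "B i l \<noteq> 0" for i l
    proof -
      have "B i i = 0" using False that(1) by blast
      then have "fscal (2 * (2 * B i l)) * com i \<in> J"
        using pair[OF that(1-3)] by (simp add: fscal_simps(1))
      then show ?thesis by (rule ideal_fscal_cancel[OF J, rotated]) (simp only: mult_eq_0_iff two that(4) simp_thms)
    qed
    have com_a: "com a \<in> J" using off_diagonal ab \<open>a \<noteq> b\<close> by blast
    have "B b a \<noteq> 0" using symm[OF ab(1,2)] ab(3) by auto
    then have com_b: "com b \<in> J" using off_diagonal ab \<open>a \<noteq> b\<close> by blast
    show ?thesis
    proof (cases "k = a \<or> k = b")
      case True
      then show ?thesis using com_a com_b by (auto simp: com_def)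
    next
      case k_new: False
      have "\<mu> b k * \<mu> a k * B a b = B a b" "\<mu> a b * B a k = \<mu> b k * B a k"
          "\<mu> a b * \<mu> a k * B b k = B b k"
        using cons[unfolded overlap_consistent_def, THEN bspec, OF ab(1), THEN bspec, OF ab(2),
            THEN bspec, OF k] k_new \<open>a \<noteq> b\<close> by (simp_all del: mult_cancel_right1 mult_cancel_right)
      then have "overlap (\<mu> a b) (\<mu> a k) (\<mu> b k) (B a b) (B a k) (B b k) y (g a) (g b) (g k) =
          fscal (2 * B a b) * com k + fscal (2 * (\<mu> a b * B a k)) * com b + fscal (2 * B b k) * com a"
        by (simp only: overlap_def collect1 collect com_def)
      with ov[OF ab(1,2) k]
      have sum: "fscal (2 * B a b) * com k + fscal (2 * (\<mu> a b * B a k)) * com b + fscal (2 * B b k) * com a \<in> J"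
        by simp
      have "fscal (2 * (\<mu> a b * B a k)) * com b \<in> J" "fscal (2 * B b k) * com a \<in> J"
        by (intro J_left com_a com_b free_algebra_closed)+
      from J_diff[OF J_diff[OF sum this(2)] this(1)]
      have "fscal (2 * B a b) * com k \<in> J" by simp
      then have "com k \<in> J" by (rule ideal_fscal_cancel[OF J, rotated]) (use ab(3) two in simp)
      then show ?thesis by (simp add: com_def)
    qed
  qed
qed

section \<open>The algebra with a central generator\<close>

lemma UP_const_mult:
  assumes a: "a \<in> carrier (free_algebra S)" and p: "p \<in> carrier (UP (free_algebra S))"
  shows "up_ring.monom (UP (free_algebra S)) a 0 \<otimes>\<^bsub>UP (free_algebra S)\<^esub> p = (\<lambda>k. a * p k)"
    and "p \<otimes>\<^bsub>UP (free_algebra S)\<^esub> up_ring.monom (UP (free_algebra S)) a 0 = (\<lambda>k. p k * a)"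
proof -
  let ?m = "up_ring.monom (UP (free_algebra S)) a 0"
  have m: "?m \<in> carrier (UP (free_algebra S))" using a by simp
  have "(\<Sum>i\<le>k. (if i = 0 then a else 0) * p (k - i)) = a * p k" for k
  proof -
    have "(\<Sum>i\<le>k. (if i = 0 then a else 0) * p (k - i)) = (\<Sum>i\<le>k. if i = 0 then a * p k else 0)"
      by (intro sum.cong) auto
    then show ?thesis by simp
  qed
  then show "?m \<otimes>\<^bsub>UP (free_algebra S)\<^esub> p = (\<lambda>k. a * p k)"
    unfolding UP_mult[OF m p] unfolding UP_monom[OF a] by (rule ext)
  have "(\<Sum>i\<le>k. p i * (if k - i = 0 then a else 0)) = p k * a" for k
  proof -
    have "(\<Sum>i\<le>k. p i * (if k - i = 0 then a else 0)) = (\<Sum>i\<le>k. if i = k then p k * a else 0)"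
      by (intro sum.cong) auto
    then show ?thesis by simp
  qed
  then show "p \<otimes>\<^bsub>UP (free_algebra S)\<^esub> ?m = (\<lambda>k. p k * a)"
    unfolding UP_mult[OF p m] unfolding UP_monom[OF a] by (rule ext)
qed

lemma UP_const_hom:
  "(\<lambda>a. up_ring.monom (UP (free_algebra S)) a 0) \<in> ring_hom (free_algebra S) (UP (free_algebra S))"
proof (rule ring_hom_memI)
  fix a b :: "('a, 'b) free_alg"
  assume ab: "a \<in> carrier (free_algebra S)" "b \<in> carrier (free_algebra S)"
  let ?m = "\<lambda>a::('a, 'b) free_alg. up_ring.monom (UP (free_algebra S)) a 0"
  show "?m (a \<otimes>\<^bsub>free_algebra S\<^esub> b) = ?m a \<otimes>\<^bsub>UP (free_algebra S)\<^esub> ?m b"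
    using ab by (simp add: UP_const_mult) (simp add: UP_monom fun_eq_iff)
  show "?m (a \<oplus>\<^bsub>free_algebra S\<^esub> b) = ?m a \<oplus>\<^bsub>UP (free_algebra S)\<^esub> ?m b"
    using ab by (simp add: UP_add) (simp add: UP_monom fun_eq_iff)
qed (simp_all, simp add: UP_monom UP_one)

text \<open>
  A generator of the defining ideal by its coefficients: the quadratic part has degree zero in the
  central variable, the scalar \<open>- 2 B i j\<close> is the coefficient of its first power.
\<close>

definition A_relation :: "(nat \<Rightarrow> nat \<Rightarrow> 'k::field) \<Rightarrow> (nat \<Rightarrow> nat \<Rightarrow> 'k) \<Rightarrow> nat \<Rightarrow> nat \<Rightarrow>
    nat \<Rightarrow> (nat, 'k) free_alg" where
  "A_relation \<mu> B i j = (\<lambda>k. if k = 0 then fgen i * fgen j + fscal (\<mu> i j) * (fgen j * fgen i)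
     else if k = 1 then - fscal (2 * B i j) else 0)"

lemma A_relation_component:
  assumes "i \<in> {1..n}" "j \<in> {1..n}"
  shows "A_relation \<mu> B i j \<in> free_poly_component {1..n} 2"
proof -
  have "\<forall>k. A_relation \<mu> B i j k \<in> carrier (free_algebra {1..n})"
    using assms by (auto simp: A_relation_def intro!: free_algebra_closed)
  moreover have "\<forall>k>1. A_relation \<mu> B i j k = 0" by (simp add: A_relation_def)
  ultimately have "A_relation \<mu> B i j \<in> carrier (UP (free_algebra {1..n}))"
    unfolding UP_carrier_iff by blast
  moreover have "length (letters w) + 2 * k = 2"
    if "Poly_Mapping.lookup (A_relation \<mu> B i j k) w \<noteq> 0" for k w
    using that
    by (auto simp: A_relation_def fgen_def fscal_def mult_single lookup_add lookup_single
        plus_fmonoid_def when_def split: if_splits)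
  ultimately show ?thesis by (simp add: free_poly_component_def in_keys_iff)
qed

lemma A_relation_carrier:
  "i \<in> {1..n} \<Longrightarrow> j \<in> {1..n} \<Longrightarrow> A_relation \<mu> B i j \<in> carrier (UP (free_algebra {1..n}))"
  using A_relation_component[of i n j \<mu> B] unfolding free_poly_component_def by blast

lemma A_ideal_eq:
  "A_ideal n \<mu> B = Idl\<^bsub>free_poly n\<^esub> {A_relation \<mu> B i j | i j. i \<in> {1..n} \<and> j \<in> {1..n}}"
proof -
  let ?P = "free_poly n :: ((nat, 'a) free_alg, nat \<Rightarrow> (nat, 'a) free_alg) up_ring"
  let ?F = "free_algebra {1..n} :: (nat, 'a) free_alg ring"
  let ?c = "\<lambda>a::(nat, 'a) free_alg. up_ring.monom ?P a 0"
  have P: "?P = UP ?F" by (simp add: free_poly_def)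
  interpret P: ring ?P unfolding P by (rule ring_UP_free_algebra)
  note c_hom = UP_const_hom[where S = "{1..n}" and 'b = 'a, folded P]
  have c_mult: "?c a \<otimes>\<^bsub>?P\<^esub> ?c b = ?c (a * b)" and c_add: "?c a \<oplus>\<^bsub>?P\<^esub> ?c b = ?c (a + b)"
    if "a \<in> carrier ?F" "b \<in> carrier ?F" for a b
    using ring_hom_mult[OF c_hom that] ring_hom_add[OF c_hom that] by (simp_all only: free_algebra_simps)
  have "(poly_X n i \<otimes>\<^bsub>?P\<^esub> poly_X n j) \<oplus>\<^bsub>?P\<^esub> (poly_scal n (\<mu> i j) \<otimes>\<^bsub>?P\<^esub> (poly_X n j \<otimes>\<^bsub>?P\<^esub> poly_X n i))
      \<ominus>\<^bsub>?P\<^esub> (poly_scal n (2 * B i j) \<otimes>\<^bsub>?P\<^esub> poly_y n) = A_relation \<mu> B i j"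
    if ij: "i \<in> {1..n}" "j \<in> {1..n}" for i j
  proof -
    let ?q = "fgen i * fgen j + fscal (\<mu> i j) * (fgen j * fgen i) :: (nat, 'a) free_alg"
    have g: "fgen i \<in> carrier ?F" "fgen j \<in> carrier ?F" using ij by (simp_all only: free_algebra_closed)
    have q: "?q \<in> carrier ?F" using g by blast
    have lhs: "(poly_X n i \<otimes>\<^bsub>?P\<^esub> poly_X n j) \<oplus>\<^bsub>?P\<^esub>
        (poly_scal n (\<mu> i j) \<otimes>\<^bsub>?P\<^esub> (poly_X n j \<otimes>\<^bsub>?P\<^esub> poly_X n i)) = ?c ?q"
      unfolding poly_X_def poly_scal_def
      by (simp only: c_mult c_add g free_algebra_mult_closed free_algebra_closed(3))
    define z where "z = poly_scal n (2 * B i j) \<otimes>\<^bsub>?P\<^esub> poly_y n"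
    have y: "poly_y n \<in> carrier ?P"
      unfolding poly_y_def P by (rule UP_monom_closed[OF free_algebra_closed(2)])
    have s: "poly_scal n (2 * B i j) \<in> carrier ?P"
      unfolding poly_scal_def P by (rule UP_monom_closed[OF free_algebra_closed(3)])
    have z_carrier: "z \<in> carrier ?P" unfolding z_def by (rule P.m_closed[OF s y])
    have z: "z = (\<lambda>k. fscal (2 * B i j) * (if k = 1 then 1 else 0))"
      unfolding z_def poly_scal_def P
      using UP_const_mult(1)[OF free_algebra_closed(3), of "poly_y n" "{1..n}" "2 * B i j"] y
      unfolding P poly_y_def UP_monom[OF free_algebra_closed(2)] .
    have "?c ?q \<oplus>\<^bsub>?P\<^esub> \<ominus>\<^bsub>?P\<^esub> z = (\<lambda>k. ?c ?q k + (\<ominus>\<^bsub>?P\<^esub> z) k)"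
      using UP_monom_closed[OF q, of 0] P.a_inv_closed[OF z_carrier] unfolding P by (rule UP_add)
    also have "\<dots> = (\<lambda>k. ?c ?q k + - z k)"
      using z_carrier unfolding P by (simp only: UP_a_inv)
    also have "\<dots> = A_relation \<mu> B i j"
      unfolding P UP_monom[OF q] by (auto simp: A_relation_def fun_eq_iff z)
    finally show ?thesis unfolding lhs z_def by (simp only: a_minus_def)
  qed
  then show ?thesis
    unfolding A_ideal_def Let_def by (simp only: cong: rev_conj_cong)
qed

lemma A_component_eq:
  fixes \<mu> B :: "nat \<Rightarrow> nat \<Rightarrow> 'k::field"
  shows "A_component n \<mu> B d = (+>\<^bsub>free_poly n\<^esub>) (A_ideal n \<mu> B) ` free_poly_component {1..n} d"
proof -
  have "{p \<in> carrier (free_poly n). \<forall>i. \<forall>w \<in> Poly_Mapping.keys (up_ring.coeff (free_poly n) p i).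
      length (letters w) + 2 * i = d} = (free_poly_component {1..n} d :: (nat \<Rightarrow> (nat, 'k) free_alg) set)"
    by (auto simp: free_poly_component_def free_poly_def)
  then show ?thesis by (simp only: A_component_def)
qed

text \<open>
  The relations are homogeneous of degree two, so the grading of the polynomial ring descends.
\<close>

lemma A_graded: "graded_algebra (A_algebra n \<mu> B) (A_scal n \<mu> B) (A_component n \<mu> B)"
proof -
  let ?P = "UP (free_algebra {1..n}) :: ((nat, 'a) free_alg, nat \<Rightarrow> (nat, 'a) free_alg) up_ring"
  let ?I = "A_ideal n \<mu> B" and ?A = "A_algebra n \<mu> B"
  interpret P: graded_ring ?P "free_poly_component {1..n}" free_poly_projection
    by (rule free_poly_graded)
  let ?Q = "{A_relation \<mu> B i j | i j. i \<in> {1..n} \<and> j \<in> {1..n}}"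
  have Q: "?Q \<subseteq> (\<Union>d. free_poly_component {1..n} d)" using A_relation_component by blast
  have I_eq: "?I = Idl\<^bsub>?P\<^esub> ?Q" by (simp only: A_ideal_eq free_poly_def)
  interpret I: ideal ?I ?P
    unfolding I_eq by (rule P.genideal_ideal) (use A_relation_carrier in blast)
  have A_eq: "?A = ?P Quot ?I" by (simp only: A_algebra_def free_poly_def)
  have comp: "A_component n \<mu> B d = (+>\<^bsub>?P\<^esub>) ?I ` free_poly_component {1..n} d" for d
    by (simp only: A_component_eq free_poly_def)
  obtain pr where "graded_ring ?A (A_component n \<mu> B) pr"
    using P.quotient_graded[OF Q] unfolding A_eq comp[abs_def] I_eq by blast
  then interpret A: graded_ring ?A "A_component n \<mu> B" pr .
  interpret \<pi>: ring_hom_ring ?P ?A "(+>\<^bsub>?P\<^esub>) ?I" unfolding A_eq by (rule I.rcos_ring_hom_ring)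
  have scal: "A_scal n \<mu> B c = ?I +>\<^bsub>?P\<^esub> up_ring.monom ?P (fscal c) 0" for c
    by (simp add: A_scal_def poly_scal_def free_poly_def)
  have scal_0: "A_scal n \<mu> B c \<in> A_component n \<mu> B 0" for c
  proof -
    have "up_ring.monom ?P (fscal c) 0 \<in> carrier ?P" by simp
    moreover have "length (letters w) + 2 * i = 0"
      if "w \<in> Poly_Mapping.keys (up_ring.monom ?P (fscal c) 0 i)" for i w
      using that unfolding UP_monom[OF free_algebra_closed(3)]
      by (auto simp: fscal_def split: if_splits)
    ultimately have "up_ring.monom ?P (fscal c) 0 \<in> free_poly_component {1..n} 0"
      unfolding free_poly_component_def by blast
    then show ?thesis unfolding comp scal by blast
  qed
  have hom: "A_scal n \<mu> B \<in> ring_hom ring_of_type_algebra ?A"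
  proof -
    have "fscal \<in> ring_hom ring_of_type_algebra (free_algebra {1..n} :: (nat, 'a) free_alg ring)"
      by (rule ring_hom_memI) (simp_all add: ring_of_type_algebra_def fscal_simps)
    from ring_hom_trans[OF ring_hom_trans[OF this UP_const_hom] \<pi>.homh]
    show ?thesis by (simp add: comp_def scal[abs_def])
  qed
  have central: "A_scal n \<mu> B c \<otimes>\<^bsub>?A\<^esub> a = a \<otimes>\<^bsub>?A\<^esub> A_scal n \<mu> B c"
    if a: "a \<in> carrier ?A" for c a
  proof -
    obtain p where p: "p \<in> carrier ?P" "a = ?I +>\<^bsub>?P\<^esub> p"
      using a unfolding A_eq I.quotient_carrier by blast
    let ?m = "up_ring.monom ?P (fscal c) 0"
    have m: "?m \<in> carrier ?P" by (rule UP_monom_closed[OF free_algebra_closed(3)])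
    have comm: "?m \<otimes>\<^bsub>?P\<^esub> p = p \<otimes>\<^bsub>?P\<^esub> ?m"
      unfolding UP_const_mult[OF free_algebra_closed(3) p(1)]
      by (rule ext) (rule fscal_commute[symmetric])
    show ?thesis
      unfolding p(2) scal \<pi>.hom_mult[OF m p(1), symmetric] \<pi>.hom_mult[OF p(1) m, symmetric] comm ..
  qed
  show ?thesis
    unfolding graded_algebra_def algebra_over_def
  proof (intro conjI allI ballI impI A.ring_axioms hom A.H_subgroup A.one_H A.mult_H
      A.unique_decomposition)
    show "A_scal n \<mu> B c \<otimes>\<^bsub>?A\<^esub> a \<in> A_component n \<mu> B d" if "a \<in> A_component n \<mu> B d" for c a d
      using A.mult_H[OF scal_0 that] by simp
  qed (assumption | rule central)+
qed

section \<open>Eliminating the central generator\<close>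

lemma ideal_sum_closed:
  assumes J: "ideal J (free_algebra S)" and "\<And>i. i \<in> I \<Longrightarrow> f i \<in> J"
  shows "sum f I \<in> J"
  using assms(2)
  by (induction I rule: infinite_finite_induct)
     (simp_all add: ideal_free_algebraD(2)[OF J] ideal_free_algebraD(3)[OF J])

text \<open>
  The elements that commute with \<open>y\<close> modulo \<open>J\<close> are closed under sums and products, so testing the
  generators is enough.
\<close>

lemma central_mod_ideal:
  assumes J: "ideal J (free_algebra S)" and y: "y \<in> carrier (free_algebra S)"
    and gens: "\<And>s. s \<in> S \<Longrightarrow> fgen s * y - y * fgen s \<in> J"
    and f: "f \<in> carrier (free_algebra S)"
  shows "y ^ m * f - f * y ^ m \<in> J"
proof (induction m)
  case 0
  then show ?case by (simp add: ideal_free_algebraD(2)[OF J])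
next
  case (Suc m)
  have "f * y - y * f \<in> J"
    using f
  proof (induction rule: free_algebra_induct)
    case (scal c)
    then show ?case by (simp add: fscal_commute[of y] ideal_free_algebraD(2)[OF J])
  next
    case (gen a p)
    have "fgen a * (p * y - y * p) + (fgen a * y - y * fgen a) * p \<in> J"
      by (rule ideal_free_algebraD(3)[OF J ideal_free_algebraD(6)[OF J gen(3)]
            ideal_free_algebraD(7)[OF J gens[OF gen(1)] gen(2)]]) (use gen in auto)
    then show ?case by (simp add: algebra_simps)
  next
    case (add p q)
    have "(p * y - y * p) + (q * y - y * q) \<in> J"
      by (rule ideal_free_algebraD(3)[OF J add(3,4)])
    then show ?case by (simp add: algebra_simps)
  qed
  then have fy: "- (f * y - y * f) \<in> J" by (rule ideal_free_algebraD(4)[OF J])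
  have ym: "y ^ m \<in> carrier (free_algebra S)" using y by (induction m) auto
  have "y * (y ^ m * f - f * y ^ m) + - (f * y - y * f) * y ^ m \<in> J"
    by (rule ideal_free_algebraD(3)[OF J ideal_free_algebraD(6)[OF J Suc y]
          ideal_free_algebraD(7)[OF J fy ym]])
  then show ?case by (simp add: algebra_simps)
qed

text \<open>
  The substitution of \<open>y\<close> for the variable of a polynomial over the free algebra, with the letters
  renamed by \<open>\<theta>\<close>. It is additive but in general not multiplicative.
\<close>

definition substitute ::
  "(nat \<Rightarrow> 'a) \<Rightarrow> ('a, 'k::field) free_alg \<Rightarrow> (nat \<Rightarrow> (nat, 'k) free_alg) \<Rightarrow> ('a, 'k) free_alg" where
  "substitute \<theta> y p = (\<Sum>i\<in>{i. p i \<noteq> 0}. frename \<theta> (p i) * y ^ i)"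

lemma substitute_bound:
  assumes "\<forall>i>N. p i = 0"
  shows "substitute \<theta> y p = (\<Sum>i\<le>N. frename \<theta> (p i) * y ^ i)"
proof -
  have "i \<le> N" if "p i \<noteq> 0" for i using assms that by (cases "i \<le> N") auto
  then show ?thesis
    unfolding substitute_def by (intro sum.mono_neutral_left) auto
qed

lemma sum_triangle:
  fixes g :: "nat \<Rightarrow> nat \<Rightarrow> 'c::comm_monoid_add"
  assumes "\<And>i j. i > N \<or> j > M \<Longrightarrow> g i j = 0"
  shows "(\<Sum>k\<le>N + M. \<Sum>i\<le>k. g i (k - i)) = (\<Sum>i\<le>N. \<Sum>j\<le>M. g i j)"
proof -
  have "(\<Sum>k\<le>N + M. \<Sum>i\<le>k. g i (k - i)) = (\<Sum>(i, j)\<in>{(i, j). i + j \<le> N + M}. g i j)"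
    by (rule sum.triangle_reindex_eq[symmetric])
  also have "\<dots> = (\<Sum>(i, j)\<in>{..N} \<times> {..M}. g i j)"
  proof (rule sum.mono_neutral_right)
    have "{(i, j). i + j \<le> N + M} \<subseteq> {..N + M} \<times> {..N + M}" by auto
    then show "finite {(i, j). i + j \<le> N + M}" by (rule finite_subset) simp
    show "\<forall>ij\<in>{(i, j). i + j \<le> N + M} - {..N} \<times> {..M}. (case ij of (i, j) \<Rightarrow> g i j) = 0"
    proof
      fix ij assume "ij \<in> {(i, j). i + j \<le> N + M} - {..N} \<times> {..M}"
      then obtain i j where "ij = (i, j)" "i > N \<or> j > M" by fastforce
      then show "(case ij of (i, j) \<Rightarrow> g i j) = 0" using assms[of i j] by simp
    qed
  qed auto
  also have "\<dots> = (\<Sum>i\<le>N. \<Sum>j\<le>M. g i j)" by (simp add: sum.cartesian_product)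
  finally show ?thesis .
qed

text \<open>
  The only obstruction to multiplicativity is that powers of \<open>y\<close> have to be moved to the right past
  the coefficients of the second polynomial.
\<close>

lemma substitute_mult:
  assumes J: "ideal J (free_algebra T)" and y: "y \<in> carrier (free_algebra T)"
    and central: "\<And>m f. f \<in> carrier (free_algebra T) \<Longrightarrow> y ^ m * f - f * y ^ m \<in> J"
    and \<theta>: "\<theta> ` S \<subseteq> T"
    and p: "p \<in> carrier (UP (free_algebra S))" and q: "q \<in> carrier (UP (free_algebra S))"
  shows "substitute \<theta> y p * substitute \<theta> y q - substitute \<theta> y (p \<otimes>\<^bsub>UP (free_algebra S)\<^esub> q) \<in> J"
proof -
  obtain N where N: "\<forall>i>N. p i = 0" using p by (auto simp: UP_carrier_iff)
  obtain M where M: "\<forall>i>M. q i = 0" using q by (auto simp: UP_carrier_iff)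
  define P Q where "P i = frename \<theta> (p i)" and "Q i = frename \<theta> (q i)" for i
  have PQ: "P i \<in> carrier (free_algebra T)" "Q i \<in> carrier (free_algebra T)" for i
    using p q \<theta> by (auto simp: P_def Q_def UP_carrier_iff intro!: frename_closed[where S = S])
  have y_pow: "y ^ m \<in> carrier (free_algebra T)" for m using y by (induction m) auto
  have sum_hom: "frename \<theta> (\<Sum>i\<in>I. f i) = (\<Sum>i\<in>I. frename \<theta> (f i))"
    for I :: "nat set" and f :: "nat \<Rightarrow> (nat, 'b) free_alg"
    by (induction I rule: infinite_finite_induct) simp_all
  have pq: "(p \<otimes>\<^bsub>UP (free_algebra S)\<^esub> q) k = (\<Sum>i\<le>k. p i * q (k - i))" for k
    by (simp only: UP_mult[OF p q])
  have "\<forall>k>N + M. (p \<otimes>\<^bsub>UP (free_algebra S)\<^esub> q) k = 0"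
  proof (intro allI impI)
    fix k assume k: "k > N + M"
    \<comment> \<open>One of the two indices exceeds its bound.\<close>
    have "p i * q (k - i) = 0" for i
      using N M k by (cases "i > N") auto
    then show "(p \<otimes>\<^bsub>UP (free_algebra S)\<^esub> q) k = 0" unfolding pq by simp
  qed
  then have "substitute \<theta> y (p \<otimes>\<^bsub>UP (free_algebra S)\<^esub> q) =
      (\<Sum>k\<le>N + M. \<Sum>i\<le>k. P i * Q (k - i) * y ^ k)"
    by (simp add: substitute_bound pq sum_hom sum_distrib_right P_def Q_def)
  also have "\<dots> = (\<Sum>k\<le>N + M. \<Sum>i\<le>k. P i * Q (k - i) * y ^ (i + (k - i)))"
    by (intro sum.cong refl) simp
  also have "\<dots> = (\<Sum>i\<le>N. \<Sum>j\<le>M. P i * Q j * y ^ (i + j))"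
    using N M by (intro sum_triangle) (auto simp: P_def Q_def)
  finally have prod: "substitute \<theta> y (p \<otimes>\<^bsub>UP (free_algebra S)\<^esub> q) =
    (\<Sum>i\<le>N. \<Sum>j\<le>M. P i * Q j * y ^ (i + j))" .
  have "substitute \<theta> y p * substitute \<theta> y q =
    (\<Sum>i\<le>N. \<Sum>j\<le>M. (P i * y ^ i) * (Q j * y ^ j))"
    by (simp add: substitute_bound[OF N] substitute_bound[OF M] sum_product P_def Q_def)
  then have "substitute \<theta> y p * substitute \<theta> y q - substitute \<theta> y (p \<otimes>\<^bsub>UP (free_algebra S)\<^esub> q) =
    (\<Sum>i\<le>N. \<Sum>j\<le>M. (P i * y ^ i) * (Q j * y ^ j) - P i * Q j * y ^ (i + j))"
    by (simp add: prod sum_subtractf)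
  also have "\<dots> = (\<Sum>i\<le>N. \<Sum>j\<le>M. P i * ((y ^ i * Q j - Q j * y ^ i) * y ^ j))"
    by (intro sum.cong refl) (simp add: algebra_simps power_add)
  also have "\<dots> \<in> J"
    by (rule ideal_sum_closed[OF J], rule ideal_sum_closed[OF J],
        rule ideal_free_algebraD(6)[OF J ideal_free_algebraD(7)[OF J central[OF PQ(2)] y_pow] PQ(1)])
  finally show ?thesis .
qed

text \<open>
  This gives the inclusion of the defining ideal of an algebra with a central variable into the
  preimage of \<open>J\<close>: only the generators of the defining ideal have to be tested.
\<close>

lemma substitute_ideal:
  assumes J: "ideal J (free_algebra T)" and y: "y \<in> carrier (free_algebra T)"
    and central: "\<And>m f. f \<in> carrier (free_algebra T) \<Longrightarrow> y ^ m * f - f * y ^ m \<in> J"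
    and \<theta>: "\<theta> ` S \<subseteq> T"
  shows "ideal {p \<in> carrier (UP (free_algebra S)). substitute \<theta> y p \<in> J} (UP (free_algebra S))"
    (is "ideal ?K ?P")
proof -
  interpret P: ring ?P by (rule ring_UP_free_algebra)
  have closed: "substitute \<theta> y p \<in> carrier (free_algebra T)" if p: "p \<in> carrier ?P" for p
  proof -
    have y_pow: "y ^ m \<in> carrier (free_algebra T)" for m using y by (induction m) auto
    have "frename \<theta> (p i) \<in> carrier (free_algebra T)" for i
      using p \<theta> by (auto simp: UP_carrier_iff intro!: frename_closed[where S = S])
    then show ?thesis
      unfolding substitute_def by (intro free_algebra_sum_closed free_algebra_mult_closed y_pow)
  qed
  have sub_add: "substitute \<theta> y (p \<oplus>\<^bsub>?P\<^esub> q) = substitute \<theta> y p + substitute \<theta> y q"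
    if p: "p \<in> carrier ?P" and q: "q \<in> carrier ?P" for p q
  proof -
    obtain N where N: "\<forall>i>N. p i = 0" using p by (auto simp: UP_carrier_iff)
    obtain M where M: "\<forall>i>M. q i = 0" using q by (auto simp: UP_carrier_iff)
    have b: "\<forall>i>max N M. p i = 0" "\<forall>i>max N M. q i = 0" "\<forall>i>max N M. p i + q i = 0"
      using N M by auto
    show ?thesis
      unfolding UP_add[OF p q] substitute_bound[OF b(1)] substitute_bound[OF b(2)]
        substitute_bound[OF b(3)]
      by (simp add: distrib_right sum.distrib)
  qed
  have sub_neg: "substitute \<theta> y (\<ominus>\<^bsub>?P\<^esub> p) = - substitute \<theta> y p" if p: "p \<in> carrier ?P" for p
    unfolding UP_a_inv[OF p] by (simp add: substitute_def sum_negf)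
  have mult: "substitute \<theta> y (p \<otimes>\<^bsub>?P\<^esub> q) \<in> J"
    if "p \<in> carrier ?P" "q \<in> carrier ?P" "substitute \<theta> y p * substitute \<theta> y q \<in> J" for p q
    using ideal_free_algebraD(5)[OF J that(3) substitute_mult[OF J y central \<theta> that(1,2)]] by simp
  show ?thesis
  proof (rule idealI)
    show "ring ?P" by (rule P.ring_axioms)
    show "subgroup ?K (add_monoid ?P)"
    proof (rule P.add.subgroupI)
      have "substitute \<theta> y \<zero>\<^bsub>?P\<^esub> = 0" by (simp add: UP_zero substitute_def)
      then have "\<zero>\<^bsub>?P\<^esub> \<in> ?K" using ideal_free_algebraD(2)[OF J] by simp
      then show "?K \<noteq> {}" by blast
      show "\<ominus>\<^bsub>?P\<^esub> p \<in> ?K" if "p \<in> ?K" for p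
        using that ideal_free_algebraD(4)[OF J] by (simp add: sub_neg)
      show "p \<oplus>\<^bsub>?P\<^esub> q \<in> ?K" if "p \<in> ?K" "q \<in> ?K" for p q
        using that ideal_free_algebraD(3)[OF J] by (simp add: sub_add)
    qed blast
    show "a \<otimes>\<^bsub>?P\<^esub> p \<in> ?K" if "p \<in> ?K" "a \<in> carrier ?P" for p a
      using that ideal_free_algebraD(6)[OF J _ closed[OF that(2)]] mult[of a p] by simp
    show "p \<otimes>\<^bsub>?P\<^esub> a \<in> ?K" if "p \<in> ?K" "a \<in> carrier ?P" for p a
      using that ideal_free_algebraD(7)[OF J _ closed[OF that(2)]] mult[of p a] by simp
  qed
qed

section \<open>The quadratic presentation\<close>

lemma fhomogeneous_two:
  "a \<in> S \<Longrightarrow> b \<in> S \<Longrightarrow> fgen a * fgen b \<in> fhomogeneous S 2"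
  by (auto simp: fhomogeneous_def fgen_def mult_single plus_fmonoid_def free_algebra_carrier
      split: if_splits)

lemma fhomogeneous_add:
  "p \<in> fhomogeneous S d \<Longrightarrow> q \<in> fhomogeneous S d \<Longrightarrow> p + q \<in> fhomogeneous S d"
  using keys_add[of p q] by (auto simp: fhomogeneous_def)

lemma fhomogeneous_uminus: "p \<in> fhomogeneous S d \<Longrightarrow> - p \<in> fhomogeneous S d"
  by (auto simp: fhomogeneous_def in_keys_iff)

lemma fhomogeneous_diff:
  "p \<in> fhomogeneous S d \<Longrightarrow> q \<in> fhomogeneous S d \<Longrightarrow> p - q \<in> fhomogeneous S d"
  using fhomogeneous_add[OF _ fhomogeneous_uminus, of p S d q] by simp

lemma fhomogeneous_fscal:
  assumes "p \<in> fhomogeneous S d"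
  shows "fscal c * p \<in> fhomogeneous S d"
proof -
  have "w \<in> Poly_Mapping.keys p" if "w \<in> Poly_Mapping.keys (fscal c * p)" for w
    using keys_mult[of "fscal c" p] that by (auto simp: fscal_def split: if_splits)
  then show ?thesis using assms by (auto simp: fhomogeneous_def)
qed

text \<open>
  The generating set \<open>S\<close> consists of the classes of the variables, and \<open>J\<close> is the ideal generated by
  all quadratic relations between them. The substitution of a quadratic element for the central
  variable undoes the canonical map \<open>h\<close> modulo \<open>J\<close>, so the kernel of \<open>h\<close> is no larger than \<open>J\<close>.
\<close>

lemma A_quadratic:
  fixes \<mu> B :: "nat \<Rightarrow> nat \<Rightarrow> 'k::field"
  assumes two: "(2::'k) \<noteq> 0"
    and \<mu>: "\<And>i. i \<in> {1..n} \<Longrightarrow> \<mu> i i = 1"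
    and symm: "\<And>i j. i \<in> {1..n} \<Longrightarrow> j \<in> {1..n} \<Longrightarrow> B i j = \<mu> i j * B j i"
    and cons: "overlap_consistent n \<mu> B"
    and nonzero: "\<exists>i\<in>{1..n}. \<exists>j\<in>{1..n}. B i j \<noteq> 0"
  shows "quadratic_algebra (A_algebra n \<mu> B) (A_scal n \<mu> B) (A_component n \<mu> B)"
proof -
  let ?F = "free_algebra {1..n} :: (nat, 'k) free_alg ring"
  let ?P = "UP ?F"
  let ?I = "A_ideal n \<mu> B" and ?A = "A_algebra n \<mu> B"
  let ?c = "\<lambda>a::(nat, 'k) free_alg. up_ring.monom ?P a 0"
  let ?R = "A_relation \<mu> B"
  interpret F: ring ?F by (rule ring_free_algebra)
  interpret P: ring ?P by (rule ring_UP_free_algebra)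
  have gens: "{?R i j | i j. i \<in> {1..n} \<and> j \<in> {1..n}} \<subseteq> carrier ?P"
    using A_relation_carrier by blast
  have I_eq: "?I = Idl\<^bsub>?P\<^esub> {?R i j | i j. i \<in> {1..n} \<and> j \<in> {1..n}}"
    by (simp only: A_ideal_eq free_poly_def)
  have I: "ideal ?I ?P" unfolding I_eq by (rule P.genideal_ideal[OF gens])
  interpret I: ideal ?I ?P by (rule I)
  have R_in: "?R i j \<in> ?I" if "i \<in> {1..n}" "j \<in> {1..n}" for i j
    unfolding I_eq using P.genideal_self[OF gens] that by blast
  have A_eq: "?A = ?P Quot ?I" by (simp only: A_algebra_def free_poly_def)
  interpret A: ring ?A unfolding A_eq by (rule I.quotient_is_ring)
  interpret \<pi>: ring_hom_ring ?P ?A "(+>\<^bsub>?P\<^esub>) ?I" unfolding A_eq by (rule I.rcos_ring_hom_ring)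

  define \<rho> where "\<rho> f = ?I +>\<^bsub>?P\<^esub> ?c f" for f
  have \<rho>_hom: "\<rho> \<in> ring_hom ?F ?A"
    using ring_hom_trans[OF UP_const_hom \<pi>.homh] by (simp only: comp_def \<rho>_def[abs_def])
  have \<rho>_mult: "\<rho> (f * g) = \<rho> f \<otimes>\<^bsub>?A\<^esub> \<rho> g" and \<rho>_add: "\<rho> (f + g) = \<rho> f \<oplus>\<^bsub>?A\<^esub> \<rho> g"
    if "f \<in> carrier ?F" "g \<in> carrier ?F" for f g
    using ring_hom_mult[OF \<rho>_hom that] ring_hom_add[OF \<rho>_hom that] by simp_all
  define \<theta> where "\<theta> i = \<rho> (fgen i)" for i
  define S where "S = \<theta> ` {1..n}"
  \<comment> \<open>A section of \<open>\<theta>\<close>: if several variables have the same class, one of them represents it.\<close>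
  define \<tau> where "\<tau> s = (SOME i. i \<in> {1..n} \<and> \<theta> i = s)" for s
  have \<tau>: "\<tau> s \<in> {1..n}" "\<theta> (\<tau> s) = s" if "s \<in> S" for s
  proof -
    have "\<exists>i. i \<in> {1..n} \<and> \<theta> i = s" using that unfolding S_def by blast
    from someI_ex[OF this] show "\<tau> s \<in> {1..n}" "\<theta> (\<tau> s) = s" unfolding \<tau>_def by blast+
  qed
  let ?G = "free_algebra S :: ((nat \<Rightarrow> (nat, 'k) free_alg) set, 'k) free_alg ring"
  interpret G: ring ?G by (rule ring_free_algebra)
  define h where "h f = \<rho> (frename \<tau> f)" for f
  have \<tau>_closed: "frename \<tau> f \<in> carrier ?F" if "f \<in> carrier ?G" for f
    by (rule frename_closed[OF that]) (use \<tau>(1) in blast)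
  have \<theta>_closed: "frename \<theta> f \<in> carrier ?G" if "f \<in> carrier ?F" for f
    by (rule frename_closed[OF that]) (simp add: S_def)
  have h_hom: "h \<in> ring_hom ?G ?A"
  proof -
    have "frename \<tau> \<in> ring_hom ?G ?F"
      by (rule ring_hom_memI) (use \<tau>_closed in simp_all)
    from ring_hom_trans[OF this \<rho>_hom] show ?thesis by (simp only: comp_def h_def[abs_def])
  qed
  interpret h: ring_hom_ring ?G ?A h by (rule ring_hom_ringI2[OF G.ring_axioms A.ring_axioms h_hom])
  have h_scal: "h (fscal c) = A_scal n \<mu> B c" for c
    by (simp add: h_def \<rho>_def A_scal_def poly_scal_def free_poly_def)
  have h_gen: "h (fgen s) = s" if "s \<in> S" for s
    using \<tau>(2)[OF that] by (simp add: h_def \<theta>_def)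
  have h_\<theta>: "h (frename \<theta> f) = \<rho> f" if "f \<in> carrier ?F" for f
    using that
  proof (induction rule: free_algebra_induct)
    case (scal c)
    show ?case by (simp add: h_def)
  next
    case (gen a p)
    have "\<theta> a \<in> S" using gen(1) by (simp add: S_def)
    have "h (frename \<theta> (fgen a * p)) = h (fgen (\<theta> a)) \<otimes>\<^bsub>?A\<^esub> h (frename \<theta> p)"
      using h.hom_mult[of "fgen (\<theta> a)" "frename \<theta> p"] \<theta>_closed[OF gen(2)] \<open>\<theta> a \<in> S\<close> by simp
    also have "\<dots> = \<rho> (fgen a) \<otimes>\<^bsub>?A\<^esub> \<rho> p"
      by (simp only: h_gen[OF \<open>\<theta> a \<in> S\<close>] gen(3)) (simp only: \<theta>_def)
    also have "\<dots> = \<rho> (fgen a * p)" using gen(1,2) by (simp only: \<rho>_mult free_algebra_closed)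
    finally show ?case .
  next
    case (add p q)
    have "h (frename \<theta> (p + q)) = h (frename \<theta> p) \<oplus>\<^bsub>?A\<^esub> h (frename \<theta> q)"
      using h.hom_add[OF \<theta>_closed[OF add(1)] \<theta>_closed[OF add(2)]] by simp
    then show ?case by (simp only: add \<rho>_add)
  qed

  obtain a b where ab: "a \<in> {1..n}" "b \<in> {1..n}" "B a b \<noteq> 0" using nonzero by blast
  have Bab: "2 * B a b \<noteq> 0" using ab(3) two by simp
  define q where "q i j = fgen i * fgen j + fscal (\<mu> i j) * (fgen j * fgen i)" for i j :: nat
  \<comment> \<open>Solves the relation for \<open>a\<close> and \<open>b\<close> for the central variable.\<close>
  define y where "y = fscal (inverse (2 * B a b)) * (q a b :: (nat, 'k) free_alg)"
  have q_closed: "q i j \<in> carrier ?F" if "i \<in> {1..n}" "j \<in> {1..n}" for i j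
    using that unfolding q_def by blast
  have y_closed: "y \<in> carrier ?F"
    unfolding y_def using q_closed[OF ab(1,2)] by blast
  have const_in: "\<rho> f = \<zero>\<^bsub>?A\<^esub> \<longleftrightarrow> ?c f \<in> ?I" if "f \<in> carrier ?F" for f
    unfolding \<rho>_def A_eq by (rule I.coset_eq_zero_iff) (rule UP_monom_closed[OF that])
  have \<rho>_rel: "\<rho> (skew_relation (\<mu> i j) (B i j) y (fgen i) (fgen j)) = \<zero>\<^bsub>?A\<^esub>"
    if ij: "i \<in> {1..n}" "j \<in> {1..n}" for i j
  proof -
    \<comment> \<open>Subtracting this multiple of the relation for \<open>a\<close>, \<open>b\<close> from the one for \<open>i\<close>, \<open>j\<close> cancels the
      central variable.\<close>
    define t where "t = 2 * B i j * inverse (2 * B a b)"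
    let ?r = "skew_relation (\<mu> i j) (B i j) y (fgen i) (fgen j)"
    have r_closed: "?r \<in> carrier ?F" using ij y_closed by (intro skew_relation_closed) auto
    have r: "?r = q i j - fscal t * q a b"
      by (simp only: skew_relation_def q_def[of i j] y_def t_def fscal_simps(4) mult.assoc)
    have m: "?c (fscal t) \<otimes>\<^bsub>?P\<^esub> ?R a b = (\<lambda>k. fscal t * ?R a b k)"
      by (rule UP_const_mult(1)[OF free_algebra_closed(3) A_relation_carrier[OF ab(1,2)]])
    have m_in: "?c (fscal t) \<otimes>\<^bsub>?P\<^esub> ?R a b \<in> ?I"
      by (rule I.I_l_closed[OF R_in[OF ab(1,2)] UP_monom_closed[OF free_algebra_closed(3)]])
    have m_carrier: "?c (fscal t) \<otimes>\<^bsub>?P\<^esub> ?R a b \<in> carrier ?P"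
      by (rule I.Icarr[OF m_in])
    have diff_in: "?R i j \<oplus>\<^bsub>?P\<^esub> \<ominus>\<^bsub>?P\<^esub> (?c (fscal t) \<otimes>\<^bsub>?P\<^esub> ?R a b) \<in> ?I"
      by (rule I.a_closed[OF R_in[OF ij] I.a_inv_closed[OF m_in]])
    have "?R i j \<oplus>\<^bsub>?P\<^esub> \<ominus>\<^bsub>?P\<^esub> (?c (fscal t) \<otimes>\<^bsub>?P\<^esub> ?R a b)
      = (\<lambda>k. ?R i j k + (\<ominus>\<^bsub>?P\<^esub> (?c (fscal t) \<otimes>\<^bsub>?P\<^esub> ?R a b)) k)"
      by (rule UP_add[OF A_relation_carrier[OF ij] P.a_inv_closed[OF m_carrier]])
    also have "\<dots> = (\<lambda>k. ?R i j k - fscal t * ?R a b k)"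
      unfolding UP_a_inv[OF m_carrier] unfolding m by simp
    also have "\<dots> = ?c ?r"
    proof -
      have "fscal t * fscal (2 * B a b) = (fscal (2 * B i j) :: (nat, 'k) free_alg)"
        by (simp only: t_def fscal_simps(4)[symmetric] mult.assoc[of "2 * B i j"] left_inverse[OF Bab]
            mult_1_right)
      then show ?thesis
        unfolding UP_monom[OF r_closed] unfolding r
        by (auto simp: fun_eq_iff A_relation_def q_def)
    qed
    finally show ?thesis using diff_in const_in[OF r_closed] by simp
  qed
  have \<rho>_y: "\<rho> y = ?I +>\<^bsub>?P\<^esub> poly_y n"
  proof -
    define u where "u = inverse (2 * B a b)"
    have y_u: "y = fscal u * q a b" by (simp only: y_def u_def)
    let ?m = "?c (fscal u) \<otimes>\<^bsub>?P\<^esub> ?R a b"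
    have y_carrier: "poly_y n \<in> carrier ?P"
      unfolding poly_y_def free_poly_def by (rule UP_monom_closed[OF free_algebra_closed(2)])
    have m: "?m = (\<lambda>k. fscal u * ?R a b k)"
      by (rule UP_const_mult(1)[OF free_algebra_closed(3) A_relation_carrier[OF ab(1,2)]])
    have m_in: "?m \<in> ?I"
      by (rule I.I_l_closed[OF R_in[OF ab(1,2)] UP_monom_closed[OF free_algebra_closed(3)]])
    have "?c y \<oplus>\<^bsub>?P\<^esub> \<ominus>\<^bsub>?P\<^esub> poly_y n = (\<lambda>k. ?c y k + (\<ominus>\<^bsub>?P\<^esub> poly_y n) k)"
      by (rule UP_add[OF UP_monom_closed[OF y_closed] P.a_inv_closed[OF y_carrier]])
    also have "\<dots> = ?m"
    proof -
      have "fscal u * fscal (2 * B a b) = (1 :: (nat, 'k) free_alg)"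
        by (simp only: u_def fscal_simps(4)[symmetric] left_inverse[OF Bab] fscal_simps(2))
      then show ?thesis
        unfolding UP_a_inv[OF y_carrier] m
        unfolding poly_y_def free_poly_def UP_monom[OF y_closed] UP_monom[OF free_algebra_closed(2)]
        by (auto simp: fun_eq_iff A_relation_def q_def y_u)
    qed
    finally have "?c y \<ominus>\<^bsub>?P\<^esub> poly_y n \<in> ?I" using m_in by (simp only: a_minus_def)
    then show ?thesis
      unfolding \<rho>_def
      using P.quotient_eq_iff_same_a_r_cos[OF I UP_monom_closed[OF y_closed] y_carrier] by simp
  qed

  define Q where "Q = {p \<in> fhomogeneous S 2. h p = \<zero>\<^bsub>?A\<^esub>}"
  define J where "J = Idl\<^bsub>?G\<^esub> Q"
  have Q_closed: "Q \<subseteq> carrier ?G" by (auto simp: Q_def fhomogeneous_def)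
  have J: "ideal J ?G" unfolding J_def by (rule G.genideal_ideal[OF Q_closed])
  define Y where "Y = frename \<theta> y"
  have Y_closed: "Y \<in> carrier ?G" unfolding Y_def by (rule \<theta>_closed[OF y_closed])
  have rel_J: "skew_relation (\<mu> i j) (B i j) Y (fgen (\<theta> i)) (fgen (\<theta> j)) \<in> J"
    if ij: "i \<in> {1..n}" "j \<in> {1..n}" for i j
  proof -
    let ?r = "skew_relation (\<mu> i j) (B i j) Y (fgen (\<theta> i)) (fgen (\<theta> j))"
    have S: "\<theta> i \<in> S" "\<theta> j \<in> S" "\<theta> a \<in> S" "\<theta> b \<in> S" using ij ab by (auto simp: S_def)
    have Y: "Y = fscal (inverse (2 * B a b)) *
        (fgen (\<theta> a) * fgen (\<theta> b) + fscal (\<mu> a b) * (fgen (\<theta> b) * fgen (\<theta> a)))"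
      by (simp add: Y_def y_def q_def)
    have "?r \<in> fhomogeneous S 2"
      unfolding skew_relation_def Y
      by (intro fhomogeneous_diff fhomogeneous_add fhomogeneous_fscal fhomogeneous_two S)
    moreover have "h ?r = \<zero>\<^bsub>?A\<^esub>"
    proof -
      have "?r = frename \<theta> (skew_relation (\<mu> i j) (B i j) y (fgen i) (fgen j))"
        by (simp add: skew_relation_def Y_def)
      then show ?thesis
        using h_\<theta>[OF skew_relation_closed[OF free_algebra_closed(4)[OF ij(1)]
              free_algebra_closed(4)[OF ij(2)] y_closed]] \<rho>_rel[OF ij] by simp
    qed
    ultimately have "?r \<in> Q" by (simp add: Q_def)
    then show ?thesis unfolding J_def using G.genideal_self[OF Q_closed] by blast
  qed
  have "fgen s * Y - Y * fgen s \<in> J" if s: "s \<in> S" for s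
  proof -
    have "fgen (\<theta> (\<tau> s)) * Y - Y * fgen (\<theta> (\<tau> s)) \<in> J"
      by (rule skew_relations_imply_central[where g = "\<lambda>i. fgen (\<theta> i)", OF two J _ rel_J
            \<mu> symm cons nonzero \<tau>(1)[OF s]]) (auto simp: S_def)
    then show ?thesis by (simp only: \<tau>(2)[OF s])
  qed
  then have central: "Y ^ m * f - f * Y ^ m \<in> J" if "f \<in> carrier ?G" for m f
    using central_mod_ideal[OF J Y_closed _ that] by blast
  have \<theta>_S: "\<theta> ` {1..n} \<subseteq> S" by (simp add: S_def)
  have "?I \<subseteq> {p \<in> carrier ?P. substitute \<theta> Y p \<in> J}"
    unfolding I_eq
  proof (rule P.genideal_minimal[OF substitute_ideal[OF J Y_closed central \<theta>_S]])
    show "{?R i j | i j. i \<in> {1..n} \<and> j \<in> {1..n}} \<subseteq> {p \<in> carrier ?P. substitute \<theta> Y p \<in> J}"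
    proof clarify
      fix i j assume ij: "i \<in> {1..n}" "j \<in> {1..n}"
      have "\<forall>k>1. ?R i j k = 0" by (simp add: A_relation_def)
      then have "substitute \<theta> Y (?R i j) = skew_relation (\<mu> i j) (B i j) Y (fgen (\<theta> i)) (fgen (\<theta> j))"
        by (simp add: substitute_bound[where N = 1] A_relation_def skew_relation_def)
      then show "?R i j \<in> carrier ?P \<and> substitute \<theta> Y (?R i j) \<in> J"
        using rel_J[OF ij] A_relation_carrier[OF ij] by simp
    qed
  qed
  then have I_sub: "substitute \<theta> Y p \<in> J" if "p \<in> ?I" for p using that by blast

  have kernel_eq: "a_kernel ?G ?A h = {f \<in> carrier ?G. h f = \<zero>\<^bsub>?A\<^esub>}"
    by (rule a_kernel_def')
  have kernel: "a_kernel ?G ?A h = J"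
  proof
    show "J \<subseteq> a_kernel ?G ?A h"
      unfolding J_def
    proof (rule G.genideal_minimal[OF h.kernel_is_ideal])
      show "Q \<subseteq> a_kernel ?G ?A h" using Q_closed unfolding kernel_eq Q_def by blast
    qed
    show "a_kernel ?G ?A h \<subseteq> J"
    proof
      fix f assume "f \<in> a_kernel ?G ?A h"
      then have f: "f \<in> carrier ?G" "h f = \<zero>\<^bsub>?A\<^esub>" unfolding kernel_eq by blast+
      have "?c (frename \<tau> f) \<in> ?I" using const_in[OF \<tau>_closed[OF f(1)]] f(2) by (simp add: h_def)
      then have "substitute \<theta> Y (?c (frename \<tau> f)) \<in> J" by (rule I_sub)
      moreover have "substitute \<theta> Y (?c (frename \<tau> f)) = frename \<theta> (frename \<tau> f)"
        unfolding UP_monom[OF \<tau>_closed[OF f(1)]] by (simp add: substitute_bound[where N = 0])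
      moreover have "\<dots> = f" by (rule frename_inverse[OF f(1)]) (rule \<tau>(2))
      ultimately show "f \<in> J" by simp
    qed
  qed

  have surj: "h ` carrier ?G = carrier ?A"
  proof
    show "h ` carrier ?G \<subseteq> carrier ?A" by auto
    \<comment> \<open>The polynomials whose class is in the image; they include the constants and the central variable.\<close>
    define W where "W = {p \<in> carrier ?P. ?I +>\<^bsub>?P\<^esub> p \<in> h ` carrier ?G}"
    have W_const: "?c f \<in> W" if f: "f \<in> carrier ?F" for f
    proof -
      have "?I +>\<^bsub>?P\<^esub> ?c f = h (frename \<theta> f)" by (simp only: h_\<theta>[OF f] \<rho>_def)
      then show ?thesis using \<theta>_closed[OF f] UP_monom_closed[OF f] by (auto simp: W_def)
    qed
    have W_y: "poly_y n \<in> W"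
    proof -
      have "?I +>\<^bsub>?P\<^esub> poly_y n = h (frename \<theta> y)" by (simp only: h_\<theta>[OF y_closed] \<rho>_y)
      moreover have "poly_y n \<in> carrier ?P"
        unfolding poly_y_def free_poly_def by (rule UP_monom_closed[OF free_algebra_closed(2)])
      ultimately show ?thesis using \<theta>_closed[OF y_closed] by (auto simp: W_def)
    qed
    have W_mult: "p \<otimes>\<^bsub>?P\<^esub> p' \<in> W" and W_add: "p \<oplus>\<^bsub>?P\<^esub> p' \<in> W" if pp': "p \<in> W" "p' \<in> W" for p p'
    proof -
      from pp' obtain f f' where f: "f \<in> carrier ?G" "f' \<in> carrier ?G"
        "?I +>\<^bsub>?P\<^esub> p = h f" "?I +>\<^bsub>?P\<^esub> p' = h f'" "p \<in> carrier ?P" "p' \<in> carrier ?P"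
        unfolding W_def by blast
      have "?I +>\<^bsub>?P\<^esub> (p \<otimes>\<^bsub>?P\<^esub> p') = h (f \<otimes>\<^bsub>?G\<^esub> f')" "?I +>\<^bsub>?P\<^esub> (p \<oplus>\<^bsub>?P\<^esub> p') = h (f \<oplus>\<^bsub>?G\<^esub> f')"
        unfolding \<pi>.hom_mult[OF f(5,6)] \<pi>.hom_add[OF f(5,6)] h.hom_mult[OF f(1,2)] h.hom_add[OF f(1,2)]
          f(3,4) by (rule refl)+
      then show "p \<otimes>\<^bsub>?P\<^esub> p' \<in> W" "p \<oplus>\<^bsub>?P\<^esub> p' \<in> W"
        unfolding W_def using G.m_closed[OF f(1,2)] G.a_closed[OF f(1,2)]
          P.m_closed[OF f(5,6)] P.a_closed[OF f(5,6)] by blast+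
    qed
    have W_monom: "up_ring.monom ?P f k \<in> W" if f: "f \<in> carrier ?F" for f k
    proof (induction k)
      case (Suc k)
      have "up_ring.monom ?P f (Suc k) = up_ring.monom ?P f k \<otimes>\<^bsub>?P\<^esub> poly_y n"
        using UP_ring.monom_mult[OF UP_ring_free_algebra f free_algebra_closed(2), of k 1]
        by (simp add: poly_y_def free_poly_def)
      then show ?case using W_mult[OF Suc W_y] by simp
    qed (rule W_const[OF f])
    have W_sum: "(\<Oplus>\<^bsub>?P\<^esub>i\<in>D. f i) \<in> W" if "finite D" "\<And>i. i \<in> D \<Longrightarrow> f i \<in> W" for D :: "nat set" and f
      using that
    proof induction
      case empty
      have "\<zero>\<^bsub>?P\<^esub> = ?c 0" unfolding UP_monom[OF free_algebra_closed(1)] UP_zero by simp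
      then show ?case using W_const[OF free_algebra_closed(1)] by (simp only: P.finsum_empty)
    next
      case (insert i D)
      then have "f \<in> insert i D \<rightarrow> carrier ?P" by (auto simp: W_def)
      then have "(\<Oplus>\<^bsub>?P\<^esub>j\<in>insert i D. f j) = f i \<oplus>\<^bsub>?P\<^esub> (\<Oplus>\<^bsub>?P\<^esub>j\<in>D. f j)"
        using insert.hyps by (intro P.finsum_insert) auto
      moreover have "f i \<in> W" "(\<Oplus>\<^bsub>?P\<^esub>j\<in>D. f j) \<in> W"
        using insert.prems insert.IH by blast+
      ultimately show ?case by (simp only: W_add)
    qed
    show "carrier ?A \<subseteq> h ` carrier ?G"
    proof
      fix z assume "z \<in> carrier ?A"
      then obtain p where p: "p \<in> carrier ?P" "z = ?I +>\<^bsub>?P\<^esub> p"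
        unfolding A_eq I.quotient_carrier by blast
      obtain N where N: "\<forall>i>N. p i = 0" using p(1) unfolding UP_carrier_iff by blast
      have pF: "p i \<in> carrier ?F" for i using p(1) unfolding UP_carrier_iff by blast
      have "(\<Oplus>\<^bsub>?P\<^esub>i\<in>{..N}. up_ring.monom ?P (p i) i) = (\<lambda>k. \<Sum>i\<le>N. up_ring.monom ?P (p i) i k)"
        using UP_monom_closed[OF pF] by (intro UP_finsum) auto
      also have "\<dots> = p"
      proof
        fix k
        show "(\<Sum>i\<le>N. up_ring.monom ?P (p i) i k) = p k"
          unfolding UP_monom[OF pF] using N by (cases "k \<le> N") auto
      qed
      finally have "p \<in> W" using W_sum[of "{..N}" "\<lambda>i. up_ring.monom ?P (p i) i"] W_monom[OF pF] by simp
      then show "z \<in> h ` carrier ?G" unfolding W_def p(2) by blast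
    qed
  qed

  have S_sub: "S \<subseteq> A_component n \<mu> B 1"
  proof
    fix s assume "s \<in> S"
    then obtain i where i: "i \<in> {1..n}" "s = ?I +>\<^bsub>?P\<^esub> ?c (fgen i)" by (auto simp: S_def \<theta>_def \<rho>_def)
    have g: "fgen i \<in> carrier ?F" by (rule free_algebra_closed(4)[OF i(1)])
    have "length (letters w) + 2 * k = 1" if "w \<in> Poly_Mapping.keys (?c (fgen i) k)" for k w
      using that unfolding UP_monom[OF g] by (auto simp: fgen_def split: if_splits)
    then have "?c (fgen i) \<in> free_poly_component {1..n} 1"
      using UP_monom_closed[OF g] unfolding free_poly_component_def by blast
    then show "s \<in> A_component n \<mu> B 1"
      unfolding A_component_eq free_poly_def i(2) by blast
  qed
  have "Q \<subseteq> fhomogeneous S 2" unfolding Q_def by blast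
  then have presented: "\<exists>Q\<subseteq>fhomogeneous S 2. a_kernel ?G ?A h = Idl\<^bsub>?G\<^esub> Q"
    by (rule exI[of _ Q, OF conjI]) (rule kernel[unfolded J_def])
  have gens: "\<forall>s \<in> S. h (fgen s) = s" by (rule ballI) (rule h_gen)
  have scal: "\<forall>c. h (fscal c) = A_scal n \<mu> B c" by (rule allI) (rule h_scal)
  have "\<exists>h \<in> ring_hom ?G ?A. (\<forall>c. h (fscal c) = A_scal n \<mu> B c) \<and> (\<forall>s \<in> S. h (fgen s) = s) \<and>
      h ` carrier ?G = carrier ?A \<and> (\<exists>Q\<subseteq>fhomogeneous S 2. a_kernel ?G ?A h = Idl\<^bsub>?G\<^esub> Q)"
    by (rule bexI[of _ h, OF _ h_hom], rule conjI[OF scal conjI[OF gens conjI[OF surj presented]]])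
  note quadratic = conjI[OF S_sub this]
  show ?thesis
    unfolding quadratic_algebra_def by (rule conjI[OF A_graded], rule exI[of _ S], rule quadratic)
qed

theorem theorem5p1:
  fixes scale :: "'k::field \<Rightarrow> 'v::ab_group_add \<Rightarrow> 'v"
    and n :: nat
    and x :: "nat \<Rightarrow> 'v"
    and \<mu> B :: "nat \<Rightarrow> nat \<Rightarrow> 'k"
    and \<phi> :: "'v \<Rightarrow> 'v \<Rightarrow> 'k"
  assumes "CHAR('k) \<noteq> 2"
    and "vector_space scale"
    and "ordered_basis scale n x"
    and "mult_antisymmetric n \<mu>"
    and "bilinear_form scale \<phi>"
    and "mu_symmetric n x \<mu> \<phi>"
    and "\<forall>i \<in> {1..n}. \<forall>j \<in> {1..n}. B i j = \<phi> (x i) (x j)"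
    and "full_dimension scale n x \<mu> \<phi>"
    and "\<exists>i \<in> {1..n}. \<exists>j \<in> {1..n}. B i j \<noteq> 0"
  shows "quadratic_algebra (A_algebra n \<mu> B) (A_scal n \<mu> B) (A_component n \<mu> B)"
proof (rule A_quadratic)
  show two: "(2::'k) \<noteq> 0"
  proof
    assume "(2::'k) = 0"
    then have "of_nat 2 = (0::'k)" by simp
    then have dvd: "CHAR('k) dvd 2" by (simp only: of_nat_eq_0_iff_char_dvd)
    then have "CHAR('k) \<le> 2" by (rule dvd_imp_le) simp
    moreover have "CHAR('k) \<noteq> 0"
    proof
      assume "CHAR('k) = 0"
      with dvd have "0 dvd (2::nat)" by (simp only:)
      then show False by simp
    qed
    moreover have "CHAR('k) \<noteq> 1" by simp
    ultimately show False using assms(1) by linarith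
  qed
  have B: "B i j = \<phi> (x i) (x j)" if "i \<in> {1..n}" "j \<in> {1..n}" for i j
    using assms(7) that by blast
  have "overlap_consistent n \<mu> B \<longleftrightarrow> overlap_consistent n \<mu> (\<lambda>i j. \<phi> (x i) (x j))"
    unfolding overlap_consistent_def by (intro ball_cong refl) (simp only: B)
  then show "overlap_consistent n \<mu> B"
    using full_dimension_overlap_consistent[OF two assms(2-4,8)] by (rule iffD2)
  show "\<exists>i \<in> {1..n}. \<exists>j \<in> {1..n}. B i j \<noteq> 0" by (rule assms(9))
  show "\<mu> i i = 1" if "i \<in> {1..n}" for i
    using assms(4) that unfolding mult_antisymmetric_def by blast
  show "B i j = \<mu> i j * B j i" if "i \<in> {1..n}" "j \<in> {1..n}" for i j
    using assms(6) that unfolding mu_symmetric_def B[OF that] B[OF that(2,1)] by blast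
qed

end
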